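(* Let $k\ge 2$ and $n\ge 2k-2$ be integers, let $F$ be a field, let $x_1,\dots,x_k\in F$ with $x_k\neq0$, and let $M$ be the $n\times n$ $k$-diagonal circulant matrix with upper-left entry $x_2$, assumed invertible. Let $y=(y_1,\dots,y_n)^{T}$ be the first column of $M^{-1}$. With the matrices $A_i,B,C_i,D,T$ defined in the context, $$y_i=\frac{(-1)^{(i+1)+k(n-2k+2)}\,x_k^{\,n-2k+2}}{|M|}\begin{vmatrix}T^{\,n-2k+2}A_i & B \\ C_i & D\end{vmatrix}\qquad (i=1,2,\dots,k-1),$$ and $$y_i=-\frac{x_1y_{i-k+1}+x_2y_{i-k+2}+\cdots+x_{k-1}y_{i-1}}{x_k}\qquad(i=k,k+1,\dots,n).$$ Since $M^{-1}$ is circulant, it is uniquely determined by these initial terms and this recursion. Moreover, the initial terms $y_1,\dots,y_{k-1}$ can be computed from $n$ and $x_1,\dots,x_k$ in $O(k^3\log n+k^4)$ arithmetic operations in $F$.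
   Context: The $k$-diagonal circulant matrix with upper-left entry $x_2$ is the $n\times n$ matrix whose entry in row $r$ and column $r+s-2$ (column indices modulo $n$ in $\{1,\dots,n\}$) is $x_s$ for $1\le r\le n$, $1\le s\le k$, all other entries being $0$; so its first row is $(x_2,x_3,\dots,x_k,0,\dots,0,x_1)$ and each row is the cyclic shift of the previous row by one position to the right. $|\cdot|$ denotes the determinant. Define the $(k-1)\times(k-1)$ matrices $$A=\begin{bmatrix} x_1 & x_2 & \cdots & x_{k-1} \\ 0 & x_1 & \cdots & x_{k-2} \\ \vdots & \vdots & \ddots & \vdots \\ 0 & 0 & \cdots & x_1 \end{bmatrix},\quad B=\begin{bmatrix} x_k & 0 & \cdots & 0 \\ x_{k-1} & x_k & \cdots & 0 \\ \vdots & \vdots & \ddots & \vdots \\ x_2 & x_3 & \cdots & x_k \end{bmatrix},\quad T=\begin{bmatrix} -\frac{x_{k-1}}{x_k} & 1 & 0 & \cdots & 0 \\ -\frac{x_{k-2}}{x_k} & 0 & 1 & \cdots & 0 \\ \vdots & \vdots & \ddots & \ddots & \vdots \\ -\frac{x_2}{x_k} & 0 & \cdots & 0 & 1 \\ -\frac{x_1}{x_k} & 0 & \cdots & 0 & 0 \end{bmatrix},$$ and the $(k-2)\times(k-1)$ matrices $$C=\begin{bmatrix} x_k & 0 & \cdots & 0 & 0 \\ x_{k-1} & x_k & \cdots & 0 & 0 \\ \vdots & \vdots & \ddots & \vdots & \vdots \\ x_3 & x_4 & \cdots & x_k & 0 \end{bmatrix},\quad D=\begin{bmatrix} x_1 &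 x_2 & \cdots & x_{k-2} & x_{k-1} \\ 0 & x_1 & \cdots & x_{k-3} & x_{k-2} \\ \vdots & \vdots & \ddots & \vdots & \vdots \\ 0 & 0 & \cdots & x_1 & x_2 \end{bmatrix}.$$ $A_i$ and $C_i$ denote the matrices obtained from $A$ and $C$ by deleting their $i$-th column. Empty blocks are allowed when $k=2$. *)

theory Defs
  imports Complex_Main "Jordan_Normal_Form.Determinant"
begin

text \<open>
  Matrices are those of \<open>Jordan_Normal_Form\<close>, whose rows and columns are numbered from 0.
  The parameters \<open>x 1, \<dots>, x k\<close> are numbered from 1; all other values of \<open>x\<close> are irrelevant.
\<close>

text \<open>
  With rows and columns numbered from 0, \<open>x s\<close> stands in row \<open>r\<close> and column \<open>r + s - 2\<close> modulo \<open>n\<close>.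
  For \<open>k \<le> n\<close> (which follows from \<open>2 \<le> k\<close> and \<open>2 * k - 2 \<le> n\<close>) these columns are distinct,
  so that the sum has at most one term.
\<close>

definition diag_circulant :: "nat \<Rightarrow> nat \<Rightarrow> (nat \<Rightarrow> 'a::field) \<Rightarrow> 'a mat" where
  "diag_circulant n k x =
     mat n n (\<lambda>(r, c). \<Sum>s | s \<in> {1..k} \<and> (int r + int s - 2) mod int n = int c. x s)"

definition circulant :: "nat \<Rightarrow> 'a mat \<Rightarrow> bool" where
  "circulant n N \<longleftrightarrow> N \<in> carrier_mat n n \<and>
     (\<forall>r<n. \<forall>c<n. N $$ ((r + 1) mod n, (c + 1) mod n) = N $$ (r, c))"

definition A_mat :: "nat \<Rightarrow> (nat \<Rightarrow> 'a::field) \<Rightarrow> 'a mat" where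
  "A_mat k x = mat (k - 1) (k - 1) (\<lambda>(r, c). if r \<le> c then x (c - r + 1) else 0)"

definition B_mat :: "nat \<Rightarrow> (nat \<Rightarrow> 'a::field) \<Rightarrow> 'a mat" where
  "B_mat k x = mat (k - 1) (k - 1) (\<lambda>(r, c). if c \<le> r then x (k - (r - c)) else 0)"

definition T_mat :: "nat \<Rightarrow> (nat \<Rightarrow> 'a::field) \<Rightarrow> 'a mat" where
  "T_mat k x = mat (k - 1) (k - 1)
     (\<lambda>(r, c). if c = 0 then - (x (k - 1 - r) / x k) else if c = r + 1 then 1 else 0)"

definition C_mat :: "nat \<Rightarrow> (nat \<Rightarrow> 'a::field) \<Rightarrow> 'a mat" where
  "C_mat k x = mat (k - 2) (k - 1) (\<lambda>(r, c). if c \<le> r then x (k - (r - c)) else 0)"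

definition D_mat :: "nat \<Rightarrow> (nat \<Rightarrow> 'a::field) \<Rightarrow> 'a mat" where
  "D_mat k x = mat (k - 2) (k - 1) (\<lambda>(r, c). if r \<le> c then x (c - r + 1) else 0)"

text \<open>The column to be deleted is numbered from 1.\<close>

definition delete_col :: "nat \<Rightarrow> 'a mat \<Rightarrow> 'a mat" where
  "delete_col i M = mat (dim_row M) (dim_col M - 1)
     (\<lambda>(r, c). M $$ (r, if c + 1 < i then c else c + 1))"

text \<open>
  The model of computation behind the operation count. A program works on finitely many
  two-dimensional arrays of field elements. Array entries are addressed by index expressions over
  the natural numbers, built from the inputs and the counters of the enclosing bounded loops. The
  index variables are lexically scoped and cannot be assigned to, so that no information about
  field elements can be moved into the (free) index arithmetic. Each arithmetic operation in the
  field, and also each test for zero, costs 1. The only field constants are 0 and 1.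
\<close>

datatype index_exp =
    Num nat
  | Var nat
  | IAdd index_exp index_exp
  | ISub index_exp index_exp
  | IMul index_exp index_exp
  | IDiv index_exp index_exp
  | IPow index_exp index_exp

primrec index_val :: "(nat \<Rightarrow> nat) \<Rightarrow> index_exp \<Rightarrow> nat" where
  "index_val env (Num m) = m"
| "index_val env (Var v) = env v"
| "index_val env (IAdd a b) = index_val env a + index_val env b"
| "index_val env (ISub a b) = index_val env a - index_val env b"
| "index_val env (IMul a b) = index_val env a * index_val env b"
| "index_val env (IDiv a b) = index_val env a div index_val env b"
| "index_val env (IPow a b) = index_val env a ^ index_val env b"

text \<open>A cell consists of the name of an array, a row index and a column index.\<close>

type_synonym cell = "nat \<times> index_exp \<times> index_exp"

definition address :: "(nat \<Rightarrow> nat) \<Rightarrow> cell \<Rightarrow> nat \<times> nat \<times> nat" where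
  "address env = (\<lambda>(a, i, j). (a, index_val env i, index_val env j))"

datatype field_op = FAdd | FSub | FMul | FDiv

text \<open>Division by zero is undefined, rather than 0 as in the class \<^class>\<open>field\<close>.\<close>

fun apply_op :: "field_op \<Rightarrow> 'a::field \<Rightarrow> 'a \<Rightarrow> 'a option" where
  "apply_op FAdd a b = Some (a + b)"
| "apply_op FSub a b = Some (a - b)"
| "apply_op FMul a b = Some (a * b)"
| "apply_op FDiv a b = (if b = 0 then None else Some (a / b))"

datatype prog =
    Skip
  | SetZero cell
  | SetOne cell
  | Copy cell cell
  | Op field_op cell cell cell
  | Seq prog prog
  | For nat index_exp prog
  | IfLess index_exp index_exp prog prog
  | IfZero cell prog prog

type_synonym 'a store = "nat \<times> nat \<times> nat \<Rightarrow> 'a"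

text \<open>
  \<open>exec P env (s, t)\<close> runs \<open>P\<close> from the store \<open>s\<close> when \<open>t\<close> operations have been spent before.
  The first cell of \<open>Copy\<close> and \<open>Op\<close> is the destination, and \<open>For v e p\<close> runs \<open>p\<close> for the values
  \<open>0, \<dots>, e - 1\<close> of the variable \<open>v\<close>.
\<close>

primrec exec :: "prog \<Rightarrow> (nat \<Rightarrow> nat) \<Rightarrow> 'a::field store \<times> nat \<Rightarrow> ('a store \<times> nat) option" where
  "exec Skip env st = Some st"
| "exec (SetZero d) env st = (case st of (s, t) \<Rightarrow> Some (s(address env d := 0), t))"
| "exec (SetOne d) env st = (case st of (s, t) \<Rightarrow> Some (s(address env d := 1), t))"
| "exec (Copy d a) env st =
     (case st of (s, t) \<Rightarrow> Some (s(address env d := s (address env a)), t))"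
| "exec (Op f d a b) env st =
     (case st of (s, t) \<Rightarrow>
        map_option (\<lambda>z. (s(address env d := z), t + 1))
          (apply_op f (s (address env a)) (s (address env b))))"
| "exec (Seq p q) env st = Option.bind (exec p env st) (exec q env)"
| "exec (For v e p) env st =
     fold (\<lambda>i r. Option.bind r (exec p (env(v := i)))) [0..<index_val env e] (Some st)"
| "exec (IfLess a b p q) env st =
     (if index_val env a < index_val env b then exec p env st else exec q env st)"
| "exec (IfZero a p q) env st =
     (case st of (s, t) \<Rightarrow>
        if s (address env a) = 0 then exec p env (s, t + 1) else exec q env (s, t + 1))"

text \<open>
  Conventions for input and output: variables 0 and 1 hold \<open>n\<close> and \<open>k\<close>; row 0 of array 0 holds
  \<open>x 1, \<dots>, x k\<close> in the columns \<open>1, \<dots>, k\<close>, and all other cells hold 0. The results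
  \<open>y 1, \<dots>, y m\<close> are read off the columns \<open>1, \<dots>, m\<close> of row 0 of array 1.
\<close>

definition input_env :: "nat \<Rightarrow> nat \<Rightarrow> nat \<Rightarrow> nat" where
  "input_env n k = (\<lambda>v. if v = 0 then n else if v = 1 then k else 0)"

definition input_store :: "nat \<Rightarrow> (nat \<Rightarrow> 'a::field) \<Rightarrow> 'a store" where
  "input_store k x = (\<lambda>(a, i, j). if a = 0 \<and> i = 0 \<and> j \<in> {1..k} then x j else 0)"

definition computes_with_cost ::
  "prog \<Rightarrow> nat \<Rightarrow> nat \<Rightarrow> (nat \<Rightarrow> 'a::field) \<Rightarrow> nat \<Rightarrow> (nat \<Rightarrow> 'a) \<Rightarrow> nat \<Rightarrow> bool" where
  "computes_with_cost P n k x m y t \<longleftrightarrow>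
     (\<exists>s. exec P (input_env n k) (input_store k x, 0) = Some (s, t) \<and>
          (\<forall>i\<in>{1..m}. s (1, 0, i) = y i))"

end

theory Submission
  imports Defs
begin

text \<open>
  By Cramer's rule the entries of the first column of the inverse are minors of the circulant, and
  each elimination step with the unwrapped rows multiplies the upper left block of such a minor by
  \<open>T\<close> and contributes a factor \<open>(-1)\<^sup>k * x k\<close>. The remaining entries satisfy the recurrence expressed
  by the unwrapped rows.

  For the operation count, let \<open>R\<close> be the companion matrix of the recurrence. The periodic extension
  of \<open>y\<close> violates the recurrence just once per period, which gives
  \<open>(I - R\<^sup>n) (y 1, \<dots>, y (k - 1)) = (0, \<dots>, 0, 1 / x k)\<close>; a vector fixed by \<open>R\<^sup>n\<close> extends to a periodic
  solution of the recurrence, that is, to an element of the kernel of the circulant, so that this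
  system is nonsingular. Binary exponentiation costs \<open>O(k\<^sup>3 log n)\<close>, and Gauss-Jordan elimination
  costs \<open>O(k\<^sup>3)\<close>.
\<close>

section \<open>Minors of the circulant\<close>

text \<open>The closed formula divides by |M|, a determinant of order n. The program avoids it by
  solving a system of order k - 1 that depends on n only through R^n. The formula and the operation
  count are therefore independent of each other, and the cost obtained, 5 k^3 log n + 11 k^3, stays
  below the claimed bound. Powers of R never occur as matrix objects. An array of coefficients is
  characterised by its effect on sequences that satisfy the recurrence, so squaring is composition
  of shifts, and the program's arrays, which have entries at all indices, need no conversion.
  Division by zero is undefined in the model, so the invertibility of M has to be turned into
  nonzero pivots. The invariant of the elimination is the null space of the augmented matrix: its
  vectors with last coordinate 0 express nonsingularity, and the vector (y, -1) expresses that y is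
  the solution.\<close>

lemma mult_mat_vec_diag_circulant:
  fixes v :: "'a::field vec"
  assumes k: "2 \<le> k" "k \<le> n" and v: "dim_vec v = n"
  shows "(diag_circulant n k x *\<^sub>v v) $ ((t + 1) mod n) = (\<Sum>j<k. x (Suc j) * v $ ((t + j) mod n))"
proof -
  \<comment> \<open>In row \<open>t + 1\<close>, counted from 0, the entry \<open>x 1\<close> stands
    in column \<open>t\<close>. Indexing the row this way makes the sum start at \<open>t\<close>
    and cancels the possibly negative \<open>s - 2\<close>.\<close>
  let ?r = "(t + 1) mod n"
  have n: "0 < n" using k by simp
  have r: "?r < n" using n by simp
  have eq: "(int ?r + int s - 2) mod int n = int c \<longleftrightarrow> c = (t + (s - 1)) mod n"
    if "s \<in> {1..k}" "c < n" for s c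
  proof -
    have "(int ?r + int s - 2) mod int n = ((int t + 1) mod int n + (int s - 2)) mod int n"
      by (simp add: of_nat_mod algebra_simps)
    also have "\<dots> = ((int t + 1) + (int s - 2)) mod int n"
      by (rule mod_add_left_eq)
    also have "\<dots> = int ((t + (s - 1)) mod n)"
      using that by (simp add: of_nat_mod of_nat_diff)
    finally show ?thesis by (metis of_nat_eq_iff)
  qed
  have "(diag_circulant n k x *\<^sub>v v) $ ?r =
      (\<Sum>c<n. (\<Sum>s | s \<in> {1..k} \<and> (int ?r + int s - 2) mod int n = int c. x s) * v $ c)"
    using r v by (simp add: diag_circulant_def scalar_prod_def atLeast0LessThan)
  also have "\<dots> = (\<Sum>c<n. \<Sum>s\<in>{1..k}. if c = (t + (s - 1)) mod n then x s * v $ c else 0)"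
  proof (rule sum.cong)
    fix c assume "c \<in> {..<n}"
    then have "{s. s \<in> {1..k} \<and> (int ?r + int s - 2) mod int n = int c}
        = {s \<in> {1..k}. c = (t + (s - 1)) mod n}"
      using eq[of _ c] by blast
    then show "(\<Sum>s | s \<in> {1..k} \<and> (int ?r + int s - 2) mod int n = int c. x s) * v $ c
        = (\<Sum>s\<in>{1..k}. if c = (t + (s - 1)) mod n then x s * v $ c else 0)"
      by (simp only: sum_distrib_right sum.inter_filter[OF finite_atLeastAtMost])
        (auto intro!: sum.cong)
  qed simp
  also have "\<dots> = (\<Sum>s\<in>{1..k}. \<Sum>c<n. if c = (t + (s - 1)) mod n then x s * v $ c else 0)"
    by (rule sum.swap)
  also have "\<dots> = (\<Sum>s\<in>{1..k}. x s * v $ ((t + (s - 1)) mod n))"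
    using n by (intro sum.cong refl) (simp add: sum.delta')
  also have "\<dots> = (\<Sum>j<k. x (Suc j) * v $ ((t + j) mod n))"
    by (rule sum.reindex_bij_witness[of _ Suc "\<lambda>s. s - 1"]) auto
  finally show ?thesis .
qed

text \<open>Row \<open>r\<close> of the minor is row \<open>r + 1\<close> of the circulant, and
  column \<open>c\<close> of the band is column \<open>c + k - 1\<close> of the circulant. The entry
  there is \<open>x s\<close> with \<open>s = c + k - r\<close>, provided that s lies between 1 and
  k.\<close>

definition band :: "nat \<Rightarrow> (nat \<Rightarrow> 'a::field) \<Rightarrow> nat \<Rightarrow> nat \<Rightarrow> 'a" where
  "band k x r c = (if c \<le> r \<and> r < c + k then x (c + k - r) else 0)"

text \<open>The minor of the circulant without its first row and one of its first \<open>k - 1\<close> columns, with the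
  upper left block replaced by \<open>E\<close>. Here \<open>p\<close> is the number of rows between the blocks \<open>E\<close> and \<open>C\<close>.\<close>

definition minor_mat :: "nat \<Rightarrow> (nat \<Rightarrow> 'a::field) \<Rightarrow> 'a mat \<Rightarrow> nat \<Rightarrow> 'a mat \<Rightarrow> 'a mat" where
  "minor_mat k x C p E = mat (2 * k - 3 + p) (2 * k - 3 + p) (\<lambda>(r, c).
     if c < k - 2 then if r < k - 1 then E $$ (r, c) else if r < k - 1 + p then 0
       else C $$ (r - (k - 1 + p), c)
     else band k x r (c - (k - 2)))"

text \<open>The first entry of the band in row 0 is \<open>x k\<close>, and no band entry stands to the right of it. Clearing
  its column by row operations therefore changes nothing but the block \<open>E\<close>, whose rows become those of
  \<open>T * E\<close> shifted down by one.\<close>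

lemma det_minor_mat_Suc:
  fixes x :: "nat \<Rightarrow> 'a::field"
  assumes k: "2 \<le> k" and xk: "x k \<noteq> 0" and E: "E \<in> carrier_mat (k - 1) (k - 2)"
  shows "det (minor_mat k x C (Suc p) E) = (-1) ^ k * x k * det (minor_mat k x C p (T_mat k x * E))"
proof -
  define N where "N = 2 * k - 3 + p"
  define G where "G = minor_mat k x C (Suc p) E"
  \<comment> \<open>Unit lower triangular: multiplication by \<open>L\<close> from the left
    subtracts from each row the multiple of row 0 that clears column \<open>k - 2\<close>.\<close>
  define L where "L = mat (Suc N) (Suc N) (\<lambda>(r, c). if r = c then 1 else if c = 0 then - (band k x r 0 / x k) else 0)"
  have G: "G \<in> carrier_mat (Suc N) (Suc N)"
    by (simp add: G_def minor_mat_def N_def)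
  have L: "L \<in> carrier_mat (Suc N) (Suc N)" by (simp add: L_def)
  have "det L = prod_list (diag_mat L)"
    by (rule det_lower_triangular[OF _ L]) (auto simp: L_def)
  also have "diag_mat L = replicate (Suc N) 1"
    by (rule nth_equalityI) (auto simp: diag_mat_def L_def simp del: upt_Suc replicate_Suc)
  finally have detL: "det L = 1" by (simp del: replicate_Suc)
  have LGsum: "(L * G) $$ (r, c) = (\<Sum>j<Suc N. L $$ (r, j) * G $$ (j, c))"
    if "r < Suc N" "c < Suc N" for r c
    using that L G by (simp add: scalar_prod_def atLeast0LessThan del: sum.lessThan_Suc)
  have LG0: "(L * G) $$ (0, c) = G $$ (0, c)" if "c < Suc N" for c
  proof -
    have "(L * G) $$ (0, c) = (\<Sum>j<Suc N. if j = 0 then G $$ (j, c) else 0)"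
      unfolding LGsum[OF zero_less_Suc that] by (rule sum.cong) (auto simp: L_def)
    then show ?thesis by (simp add: sum.delta del: sum.lessThan_Suc)
  qed
  have LG: "(L * G) $$ (Suc r, c) = G $$ (Suc r, c) - band k x (Suc r) 0 / x k * G $$ (0, c)"
    if "c < Suc N" "Suc r < Suc N" for r c
  proof -
    have "(L * G) $$ (Suc r, c) = (\<Sum>j<Suc N. (if j = Suc r then G $$ (j, c) else 0)
        + (if j = 0 then - (band k x (Suc r) 0 / x k) * G $$ (j, c) else 0))"
      unfolding LGsum[OF that(2,1)] using that by (intro sum.cong) (auto simp: L_def)
    then show ?thesis using that by (simp add: sum.distrib sum.delta del: sum.lessThan_Suc)
  qed
  have k2N: "k - 2 < Suc N" using k by (simp add: N_def)
  have Gb: "G $$ (r, c) = band k x r (c - (k - 2))" if "k - 2 \<le> c" "c < Suc N" "r < Suc N" for r c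
    using that k by (simp add: G_def minor_mat_def N_def)
  have col: "(L * G) $$ (r, k - 2) = (if r = 0 then x k else 0)" if "r < Suc N" for r
  proof (cases r)
    case 0
    then show ?thesis using k k2N by (simp add: LG0 Gb band_def)
  next
    case (Suc q)
    then show ?thesis using k k2N xk that by (simp add: LG Gb) (simp add: band_def)
  qed
  have LGc: "L * G \<in> carrier_mat (Suc N) (Suc N)" using L G by simp
  have "det G = det L * det G" by (simp add: detL)
  also have "\<dots> = det (L * G)" using L G by (simp add: det_mult)
  also have "\<dots> = (\<Sum>i<Suc N. (L * G) $$ (i, k - 2) * cofactor (L * G) i (k - 2))"
    by (rule laplace_expansion_column[OF LGc k2N])
  also have "\<dots> = (\<Sum>i<Suc N. if i = 0 then x k * cofactor (L * G) 0 (k - 2) else 0)"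
    by (rule sum.cong) (auto simp: col)
  also have "\<dots> = x k * cofactor (L * G) 0 (k - 2)"
    by (simp add: sum.delta del: sum.lessThan_Suc)
  \<comment> \<open>The pivot stands in row 0 and column \<open>k - 2\<close>. This sign, repeated p
    times, is the source of (-1)^(kp) in the formula.\<close>
  also have "cofactor (L * G) 0 (k - 2) = (-1) ^ k * det (mat_delete (L * G) 0 (k - 2))"
    using k by (simp add: cofactor_def) (metis add_diff_inverse_nat not_less power_add power2_minus one_power2 mult_1)
  also have "mat_delete (L * G) 0 (k - 2) = minor_mat k x C p (T_mat k x * E)"
  proof (rule eq_matI)
    fix r c assume "r < dim_row (minor_mat k x C p (T_mat k x * E))"
      and "c < dim_col (minor_mat k x C p (T_mat k x * E))"
    then have r: "r < N" and c: "c < N" by (simp_all add: minor_mat_def N_def)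
    have del: "mat_delete (L * G) 0 (k - 2) $$ (r, c)
        = (L * G) $$ (Suc r, if c < k - 2 then c else Suc c)"
      using r c L G by (simp add: mat_delete_def)
    show "mat_delete (L * G) 0 (k - 2) $$ (r, c) = minor_mat k x C p (T_mat k x * E) $$ (r, c)"
    proof (cases "c < k - 2")
      case False
      \<comment> \<open>Deleting row 0 and column \<open>k - 2\<close> moves the band along its
        diagonals, where it is constant. The subtracted multiple of row 0 vanishes in these columns,
        since row 0 of the band has only its first entry.\<close>
      have e: "Suc c - (k - 2) = Suc (c - (k - 2))" using False by simp
      show ?thesis using False r c
        by (simp add: del LG Gb e) (simp add: band_def minor_mat_def N_def)
    next
      case True
      \<comment> \<open>The last row of \<open>T * E\<close> receives no shifted row of
        \<open>E\<close>. This fits the minor because row \<open>k - 1\<close> belongs to the zero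
        block, which is nonempty for \<open>Suc p\<close>.\<close>
      have TE: "(T_mat k x * E) $$ (r, c) = (if Suc r < k - 1 then E $$ (Suc r, c) else 0)
          - x (k - 1 - r) / x k * E $$ (0, c)" if rk: "r < k - 1"
      proof -
        have "(T_mat k x * E) $$ (r, c) = (\<Sum>j<k-1. (if j = Suc r then E $$ (j, c) else 0)
            + (if j = 0 then - (x (k - 1 - r) / x k) * E $$ (j, c) else 0))"
          using rk True E
          by (subst index_mult_mat)
            (auto simp: T_mat_def scalar_prod_def atLeast0LessThan intro!: sum.cong)
        then show ?thesis using rk by (simp add: sum.distrib sum.delta)
      qed
      show ?thesis
      proof (cases "r < k - 1")
        case rk: True
        show ?thesis using True r c rk k TE[OF rk]
          by (simp add: del LG) (auto simp: G_def minor_mat_def N_def band_def)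
      next
        case rk: False
        show ?thesis using True r c rk k
          by (simp add: del LG) (auto simp: G_def minor_mat_def N_def band_def Suc_diff_le)
      qed
    qed
  qed (use L G in \<open>simp_all add: minor_mat_def N_def\<close>)
  finally show ?thesis by (simp add: G_def)
qed

lemma T_mat_carrier [simp]: "T_mat k x \<in> carrier_mat (k - 1) (k - 1)"
  by (simp add: T_mat_def)

text \<open>Every step uses up one of the rows that separate \<open>E\<close> from \<open>C\<close>.
  After p = n - 2k + 2 steps the blocks meet in a matrix of order 2k - 3.\<close>

lemma det_minor_mat:
  fixes x :: "nat \<Rightarrow> 'a::field"
  assumes k: "2 \<le> k" and xk: "x k \<noteq> 0" and E: "E \<in> carrier_mat (k - 1) (k - 2)"
  shows "det (minor_mat k x C p E)
    = ((-1) ^ k * x k) ^ p * det (minor_mat k x C 0 (T_mat k x ^\<^sub>m p * E))"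
  using E
proof (induction p arbitrary: E)
  case 0
  have "T_mat k x ^\<^sub>m 0 = 1\<^sub>m (k - 1)" by (simp add: T_mat_def)
  then show ?case using 0 by simp
next
  case (Suc p)
  have TE: "T_mat k x * E \<in> carrier_mat (k - 1) (k - 2)"
    using Suc.prems by (rule mult_carrier_mat[OF T_mat_carrier])
  have "T_mat k x ^\<^sub>m p * (T_mat k x * E) = T_mat k x ^\<^sub>m Suc p * E"
    using assoc_mult_mat[OF pow_carrier_mat[OF T_mat_carrier] T_mat_carrier Suc.prems]
    by simp
  then show ?case
    using Suc.IH[OF TE] by (simp add: det_minor_mat_Suc[where x = x, OF k xk Suc.prems])
qed

text \<open>Only \<open>k - 1\<close> columns of the band are left. In the first
  \<open>k - 1\<close> rows the bound \<open>r < c + k\<close> holds automatically, which leaves the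
  lower triangular \<open>B\<close>; in the remaining rows \<open>c \<le> r\<close> holds
  automatically, which leaves \<open>D\<close>.\<close>

lemma minor_mat_0:
  assumes k: "2 \<le> k" and E: "E \<in> carrier_mat (k - 1) (k - 2)" and C: "C \<in> carrier_mat (k - 2) (k - 2)"
  shows "minor_mat k x C 0 E = four_block_mat E (B_mat k x) C (D_mat k x)"
proof (rule eq_matI)
  fix r c assume "r < dim_row (four_block_mat E (B_mat k x) C (D_mat k x))"
    and "c < dim_col (four_block_mat E (B_mat k x) C (D_mat k x))"
  then have rc: "r < k - 1 + (k - 2)" "c < k - 2 + (k - 1)"
    using E C by (simp_all add: B_mat_def D_mat_def)
  obtain q where q: "k = q + 2" using k by (metis add.commute le_Suc_ex)
  show "minor_mat k x C 0 E $$ (r, c) = four_block_mat E (B_mat k x) C (D_mat k x) $$ (r, c)"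
  proof (cases "c < q")
    case True
    then show ?thesis using rc E C by (simp add: minor_mat_def B_mat_def D_mat_def q)
  next
    case False
    then obtain c' where c': "c = q + c'" by (metis le_Suc_ex not_less)
    have c'q: "c' < q + 1" using rc by (simp add: q c')
    have "minor_mat k x C 0 E $$ (r, c) = band k x r c'"
      using rc by (simp add: minor_mat_def q c')
    also have "\<dots> = four_block_mat E (B_mat k x) C (D_mat k x) $$ (r, c)"
    proof (cases "r < q + 1")
      case True
      have "band k x r c' = B_mat k x $$ (r, c')"
        using True c'q by (auto simp: band_def B_mat_def q intro!: arg_cong[of _ _ x])
      then show ?thesis using True rc E C by (simp add: B_mat_def D_mat_def q c')
    next
      case False
      then obtain r' where r': "r = q + 1 + r'" by (metis le_Suc_ex not_less)
      have "r' < q" using rc by (simp add: q r')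
      then have "band k x r c' = D_mat k x $$ (r', c')"
        using c'q by (auto simp: band_def D_mat_def q r' intro!: arg_cong[of _ _ x])
      then show ?thesis using rc E C by (simp add: B_mat_def D_mat_def q c' r')
    qed
    finally show ?thesis .
  qed
qed (use k E C in \<open>simp_all add: minor_mat_def B_mat_def D_mat_def\<close>)

text \<open>Below the first row the column \<open>r + s - 1\<close> of \<open>x s\<close> is
  nonnegative before reduction, and it is less than \<open>2 * n\<close>. Reduction modulo n
  therefore subtracts n at most once, which gives the two alternatives.\<close>

lemma diag_circulant_Suc:
  assumes k: "2 \<le> k" "k \<le> n" and r: "Suc r < n" and c: "c < n"
  shows "diag_circulant n k x $$ (Suc r, c) =
    (if r \<le> c \<and> c < r + k then x (c - r + 1)
     else if c + n < r + k then x (c + n - r + 1) else 0)"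
proof -
  define S where "S = {s \<in> {1..k}. (int (Suc r) + int s - 2) mod int n = int c}"
  have S: "s \<in> S \<longleftrightarrow> s \<in> {1..k} \<and> (r + s = c + 1 \<or> r + s = c + n + 1)" for s
  proof -
    have "(int (Suc r) + int s - 2) mod int n = int c \<longleftrightarrow> (r + (s - 1)) mod n = c" if "1 \<le> s"
    proof -
      have "int (Suc r) + int s - 2 = int (r + (s - 1))" using that by simp
      then show ?thesis by (metis of_nat_mod of_nat_eq_iff)
    qed
    moreover have "(r + (s - 1)) mod n = c \<longleftrightarrow> r + s = c + 1 \<or> r + s = c + n + 1"
      if "1 \<le> s" "s \<le> k"
    proof (cases "r + (s - 1) < n")
      case True
      then show ?thesis using that c by auto
    next
      case False
      then have "(r + (s - 1)) mod n = r + (s - 1) - n"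
        using that k r by (simp add: le_mod_geq)
      then show ?thesis using that c False by auto
    qed
    ultimately show ?thesis by (auto simp: S_def)
  qed
  have "diag_circulant n k x $$ (Suc r, c) = sum x S"
    using r c by (simp add: diag_circulant_def S_def)
  moreover have "S = (if r \<le> c \<and> c < r + k then {c - r + 1}
     else if c + n < r + k then {c + n - r + 1} else {})"
    using k r c by (auto simp: S)
  ultimately show ?thesis by simp
qed

lemma delete_col_carrier: "M \<in> carrier_mat a (b + 1) \<Longrightarrow> delete_col i M \<in> carrier_mat a b"
  by (simp add: delete_col_def)

text \<open>In the first \<open>k - 1\<close> columns, unwrapped entries occur only in the first
  \<open>k - 1\<close> rows of the minor and wrapped ones only in the last \<open>k - 2\<close>. The
  bound n >= 2k - 2 keeps these two groups of rows apart, with p zero rows between them. All further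
  columns lie to the right of the deleted one and contain no wrapped entries.\<close>

lemma mat_delete_diag_circulant:
  assumes k: "2 \<le> k" and n: "n = 2 * k - 2 + p" and i: "i \<in> {1..k - 1}"
  shows "mat_delete (diag_circulant n k x) 0 (i - 1)
    = minor_mat k x (delete_col i (C_mat k x)) p (delete_col i (A_mat k x))"
proof (rule eq_matI)
  fix r c
  assume "r < dim_row (minor_mat k x (delete_col i (C_mat k x)) p (delete_col i (A_mat k x)))"
    and "c < dim_col (minor_mat k x (delete_col i (C_mat k x)) p (delete_col i (A_mat k x)))"
  then have rc: "Suc r < n" "Suc c < n" using k n by (simp_all add: minor_mat_def)
  have kn: "k \<le> n" using k n by simp
  define d where "d = (if c < i - 1 then c else Suc c)"
  have d: "d < n" using rc by (simp add: d_def)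
  have "mat_delete (diag_circulant n k x) 0 (i - 1) $$ (r, c) = diag_circulant n k x $$ (Suc r, d)"
    using rc by (simp add: mat_delete_def diag_circulant_def d_def)
  also have "\<dots> = (if r \<le> d \<and> d < r + k then x (d - r + 1)
     else if d + n < r + k then x (d + n - r + 1) else 0)"
    by (rule diag_circulant_Suc[OF k kn rc(1) d])
  also have "\<dots> = minor_mat k x (delete_col i (C_mat k x)) p (delete_col i (A_mat k x)) $$ (r, c)"
  proof (cases "c < k - 2")
    case True
    have dk: "d < k - 1" using True by (auto simp: d_def)
    have "minor_mat k x (delete_col i (C_mat k x)) p (delete_col i (A_mat k x)) $$ (r, c)
      = (if r < k - 1 then A_mat k x $$ (r, d) else if r < k - 1 + p then 0
         else C_mat k x $$ (r - (k - 1 + p), d))"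
    proof -
      have "delete_col i (A_mat k x) $$ (r, c) = A_mat k x $$ (r, d)" if "r < k - 1"
        using True that by (simp add: delete_col_def A_mat_def d_def less_diff_conv)
      moreover have "delete_col i (C_mat k x) $$ (r - (k - 1 + p), c) = C_mat k x $$ (r - (k - 1 + p), d)"
        if "\<not> r < k - 1 + p"
      proof -
        have "r - (k - 1 + p) < k - 2" using that rc(1) n by linarith
        then show ?thesis using True by (simp add: delete_col_def C_mat_def d_def less_diff_conv)
      qed
      moreover have "r < 2 * k - 3 + p" "c < 2 * k - 3 + p" using rc n by linarith+
      ultimately show ?thesis using True by (simp add: minor_mat_def)
    qed
    also have "\<dots> = (if r \<le> d \<and> d < r + k then x (d - r + 1)
       else if d + n < r + k then x (d + n - r + 1) else 0)"
    proof -
      obtain q where q: "k = q + 2" using k by (metis add.commute le_Suc_ex)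
      have n': "n = 2 * q + 2 + p" using n by (simp add: q)
      have dq: "d < q + 1" using dk by (simp add: q)
      consider "r < q + 1" | "q + 1 \<le> r" "r < q + 1 + p" | "q + 1 + p \<le> r" by linarith
      then show ?thesis
      proof cases
        case 3
        then obtain r' where r': "r = q + 1 + p + r'" by (metis le_Suc_ex)
        have "d < q + 1" "r' < q" using rc(1) dq by (simp_all add: n' r')
        then show ?thesis by (auto simp: q n' r' C_mat_def intro!: arg_cong[of _ _ x])
      qed (use dq in \<open>auto simp: q n' A_mat_def\<close>)
    qed
    finally show ?thesis by simp
  next
    case False
    have d: "d = Suc c" using False i k by (auto simp: d_def)
    have "minor_mat k x (delete_col i (C_mat k x)) p (delete_col i (A_mat k x)) $$ (r, c)
        = band k x r (c - (k - 2))"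
      using False rc n k by (simp add: minor_mat_def)
    moreover obtain q c' where q: "k = q + 2" and c': "c = c' + q"
      using False k by (metis add.commute diff_add_inverse2 le_Suc_ex not_less)
    have "\<not> d + n < r + k" using rc by (simp add: d q c')
    moreover have "band k x r (c - (k - 2)) = (if r \<le> d \<and> d < r + k then x (d - r + 1) else 0)"
      by (auto simp: d q c' band_def Suc_diff_le)
    ultimately show ?thesis by simp
  qed
  finally show "mat_delete (diag_circulant n k x) 0 (i - 1) $$ (r, c)
    = minor_mat k x (delete_col i (C_mat k x)) p (delete_col i (A_mat k x)) $$ (r, c)" .
qed (use k n in \<open>simp_all add: minor_mat_def mat_delete_def diag_circulant_def\<close>)

lemma diag_circulant_carrier [simp]: "diag_circulant n k x \<in> carrier_mat n n"
  by (simp add: diag_circulant_def)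

section \<open>Cramer's rule and the formula for the initial terms\<close>

lemma inverse_eq_cofactor:
  fixes M :: "'a::field mat"
  assumes M: "M \<in> carrier_mat n n" and N: "N \<in> carrier_mat n n"
    and inv: "inverts_mat M N" and ij: "i < n" "j < n"
  shows "N $$ (i, j) = cofactor M j i / det M"
proof -
  have MN: "M * N = 1\<^sub>m n" using inv M by (simp add: inverts_mat_def)
  then have "det M * det N = 1" using M N by (metis det_mult det_one)
  then have det: "det M \<noteq> 0" by auto
  have "adj_mat M = adj_mat M * (M * N)"
    using adj_mat(1)[OF M] by (simp add: MN)
  also have "\<dots> = (adj_mat M * M) * N"
    using M N adj_mat(1)[OF M] by simp
  also have "\<dots> = det M \<cdot>\<^sub>m N"
    using N by (simp add: adj_mat(3)[OF M] mult_smult_assoc_mat[of _ n n])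
  finally have "adj_mat M $$ (i, j) = (det M \<cdot>\<^sub>m N) $$ (i, j)" by simp
  then show ?thesis using M N ij det by (simp add: adj_mat_def field_simps)
qed

lemma inverse_diag_circulant_initial:
  fixes x :: "nat \<Rightarrow> 'a::field"
  assumes k: "2 \<le> k" and n: "n = 2 * k - 2 + p" and xk: "x k \<noteq> 0"
    and N: "N \<in> carrier_mat n n" "inverts_mat (diag_circulant n k x) N" and i: "i \<in> {1..k - 1}"
  shows "N $$ (i - 1, 0) = (-1) ^ ((i + 1) + k * p) * x k ^ p / det (diag_circulant n k x) *
      det (four_block_mat (T_mat k x ^\<^sub>m p * delete_col i (A_mat k x)) (B_mat k x)
                          (delete_col i (C_mat k x)) (D_mat k x))"
proof -
  have A: "delete_col i (A_mat k x) \<in> carrier_mat (k - 1) (k - 2)"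
    using k by (intro delete_col_carrier) (simp add: A_mat_def numeral_2_eq_2 Suc_diff_Suc)
  have C: "delete_col i (C_mat k x) \<in> carrier_mat (k - 2) (k - 2)"
    using k by (intro delete_col_carrier) (simp add: C_mat_def numeral_2_eq_2 Suc_diff_Suc)
  have TA: "T_mat k x ^\<^sub>m p * delete_col i (A_mat k x) \<in> carrier_mat (k - 1) (k - 2)"
    using A by (rule mult_carrier_mat[OF pow_carrier_mat[OF T_mat_carrier]])
  have "N $$ (i - 1, 0) = (-1) ^ (i - 1) * det (mat_delete (diag_circulant n k x) 0 (i - 1))
      / det (diag_circulant n k x)"
    using k n i by (subst inverse_eq_cofactor[OF diag_circulant_carrier N]) (auto simp: cofactor_def)
  also have "(-1 :: 'a) ^ (i - 1) = (-1) ^ (i + 1)"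
    using i by (cases i) auto
  finally show ?thesis
    unfolding mat_delete_diag_circulant[OF k n i] det_minor_mat[where x = x, OF k xk A]
      minor_mat_0[OF k TA C]
    by (simp add: power_mult_distrib power_mult power_add)
qed

section \<open>Recurrences and the inverse\<close>

lemma Suc_mod_surj:
  assumes "r < (n::nat)"
  obtains t where "r = (t + 1) mod n"
proof
  show "r = (r + n - 1 + 1) mod n" using assms by simp
qed

lemma diag_circulant_col:
  fixes x :: "nat \<Rightarrow> 'a::field"
  assumes k: "2 \<le> k" "k \<le> n" and N: "N \<in> carrier_mat n n" and c: "c < n"
  shows "(\<Sum>j<k. x (Suc j) * N $$ ((t + j) mod n, c)) = (diag_circulant n k x * N) $$ ((t + 1) mod n, c)"
proof -
  have n: "0 < n" using c by simp
  have "(diag_circulant n k x * N) $$ ((t + 1) mod n, c)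
      = (diag_circulant n k x *\<^sub>v col N c) $ ((t + 1) mod n)"
    using n c N by (simp add: diag_circulant_def)
  also have "\<dots> = (\<Sum>j<k. x (Suc j) * col N c $ ((t + j) mod n))"
    using k N by (intro mult_mat_vec_diag_circulant) auto
  finally show ?thesis using n c N by simp
qed

text \<open>These are the rows of M N = I. As \<open>t\<close> is arbitrary, each column of N, read
  periodically, satisfies the recurrence except once per period.\<close>

lemma inverse_diag_circulant_cyclic_recursion:
  fixes x :: "nat \<Rightarrow> 'a::field"
  assumes k: "2 \<le> k" "k \<le> n"
    and N: "N \<in> carrier_mat n n" "inverts_mat (diag_circulant n k x) N" and c: "c < n"
  shows "(\<Sum>j<k. x (Suc j) * N $$ ((t + j) mod n, c)) = (if (t + 1) mod n = c then 1 else 0)"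
  using N(2) c unfolding diag_circulant_col[OF k N(1) c]
  by (simp add: inverts_mat_def diag_circulant_def)

lemma inverse_diag_circulant_recursion:
  fixes x :: "nat \<Rightarrow> 'a::field"
  assumes k: "2 \<le> k" "k \<le> n" and xk: "x k \<noteq> 0"
    and N: "N \<in> carrier_mat n n" "inverts_mat (diag_circulant n k x) N" and i: "i \<in> {k..n}"
  shows "N $$ (i - 1, 0) = - (\<Sum>j=1..k-1. x j * N $$ (i - k + j - 1, 0)) / x k"
proof -
  obtain m where m: "k = Suc m" using k by (cases k) auto
  \<comment> \<open>With \<open>t = i - k\<close> the row index \<open>t + 1\<close> lies between 1
    and \<open>n - k + 1\<close>, which is less than n because \<open>k \<ge> 2\<close>; hence it is
    not row 0. The indices \<open>t + j\<close> stay below n, so nothing wraps around.\<close>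
  have "(\<Sum>j<k. x (Suc j) * N $$ ((i - k + j) mod n, 0)) = 0"
    using k i by (subst inverse_diag_circulant_cyclic_recursion[OF k N]) auto
  also have "(\<Sum>j<k. x (Suc j) * N $$ ((i - k + j) mod n, 0))
      = (\<Sum>j<k. x (Suc j) * N $$ (i - k + j, 0))"
    using i k by (intro sum.cong) auto
  also have "\<dots> = x k * N $$ (i - 1, 0) + (\<Sum>j<m. x (Suc j) * N $$ (i - k + j, 0))"
    using i by (simp add: m)
  also have "(\<Sum>j<m. x (Suc j) * N $$ (i - k + j, 0)) = (\<Sum>j=1..m. x j * N $$ (i - k + j - 1, 0))"
    by (rule sum.reindex_bij_witness[of _ "\<lambda>j. j - 1" Suc]) auto
  finally have "x k * N $$ (i - 1, 0) = - (\<Sum>j=1..m. x j * N $$ (i - k + j - 1, 0))"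
    by (simp add: add_eq_0_iff2)
  then show ?thesis using xk by (simp add: m field_simps)
qed

text \<open>The circulant is invariant under a simultaneous cyclic shift of rows and columns, so the
  shifted inverse is again a right inverse. The left inverse identifies the two.\<close>

lemma circulant_inverse_diag_circulant:
  fixes x :: "nat \<Rightarrow> 'a::field"
  assumes k: "2 \<le> k" "k \<le> n"
    and N: "N \<in> carrier_mat n n" "inverts_mat (diag_circulant n k x) N"
      "inverts_mat N (diag_circulant n k x)"
  shows "circulant n N"
proof -
  let ?M = "diag_circulant n k x"
  define N' where "N' = mat n n (\<lambda>(r, c). N $$ ((r + 1) mod n, (c + 1) mod n))"
  have N': "N' \<in> carrier_mat n n" by (simp add: N'_def)
  have n: "0 < n" using k by simp
  have "?M * N' = 1\<^sub>m n"
  proof (rule eq_matI)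
    fix r c assume "r < dim_row (1\<^sub>m n :: 'a mat)" "c < dim_col (1\<^sub>m n :: 'a mat)"
    then have rn: "r < n" and c: "c < n" by simp_all
    obtain t where r: "r = (t + 1) mod n" using Suc_mod_surj[OF rn] .
    have "(?M * N') $$ (r, c) = (\<Sum>j<k. x (Suc j) * N' $$ ((t + j) mod n, c))"
      unfolding r by (rule diag_circulant_col[OF k N' c, symmetric])
    also have "\<dots> = (\<Sum>j<k. x (Suc j) * N $$ ((t + 1 + j) mod n, (c + 1) mod n))"
      using n c by (intro sum.cong) (simp_all add: N'_def mod_Suc_eq)
    also have "\<dots> = (if (t + 1 + 1) mod n = (c + 1) mod n then 1 else 0)"
      using n by (intro inverse_diag_circulant_cyclic_recursion[OF k N(1,2)]) simp
    also have "(t + 1 + 1) mod n = (c + 1) mod n \<longleftrightarrow> r = c"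
    proof -
      have "(t + 1 + 1) mod n = (r + 1) mod n" by (simp add: r mod_Suc_eq)
      moreover have "(r + 1) mod n = (c + 1) mod n \<longleftrightarrow> r = c"
        using rn c by (auto simp: mod_Suc split: if_splits)
      ultimately show ?thesis by simp
    qed
    finally show "(?M * N') $$ (r, c) = 1\<^sub>m n $$ (r, c)" using rn c by simp
  qed (simp_all add: N'_def diag_circulant_def)
  then have "N = N * (?M * N')" using N(1) by simp
  also have "\<dots> = (N * ?M) * N'"
    using N(1) N' by (intro assoc_mult_mat[symmetric]) auto
  also have "\<dots> = N'" using N(1,3) N' by (simp add: inverts_mat_def)
  finally have eq: "N = N'" .
  have "N $$ ((r + 1) mod n, (c + 1) mod n) = N $$ (r, c)" if "r < n" "c < n" for r c
  proof -
    have "N' $$ (r, c) = N $$ ((r + 1) mod n, (c + 1) mod n)" using that by (simp add: N'_def)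
    then show ?thesis unfolding eq[symmetric] by (rule sym)
  qed
  then show ?thesis using N(1) by (simp add: circulant_def)
qed

section \<open>Uniqueness from the initial terms and the recursion\<close>

lemma circulant_eqI:
  assumes "circulant n N" "circulant n N'" and "\<And>r. r < n \<Longrightarrow> N $$ (r, 0) = N' $$ (r, 0)"
  shows "N = N'"
proof -
  have "N $$ (r, c) = N' $$ (r, c)" if "r < n" "c < n" for r c
    using that
  proof (induction c arbitrary: r)
    case 0
    then show ?case by (simp add: assms(3))
  next
    case (Suc c)
    define r' where "r' = (if r = 0 then n - 1 else r - 1)"
    have r': "r' < n" "(r' + 1) mod n = r" using Suc.prems by (auto simp: r'_def)
    have *: "L $$ (r, Suc c) = L $$ (r', c)" if "circulant n L" for L :: "'a mat"
    proof -
      have "L $$ ((r' + 1) mod n, (c + 1) mod n) = L $$ (r', c)"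
        using that r'(1) Suc.prems(2) by (metis Suc_lessD circulant_def)
      then show ?thesis using r' Suc.prems by simp
    qed
    show ?case using Suc.IH[of r'] r' Suc.prems *[OF assms(1)] *[OF assms(2)] by simp
  qed
  then show ?thesis using assms(1,2) by (intro eq_matI) (auto simp: circulant_def)
qed

lemma circulant_recursion_unique:
  fixes x :: "nat \<Rightarrow> 'a::field"
  assumes "circulant n N" "circulant n N'" and "2 \<le> k"
    and "\<And>i. i \<in> {1..k-1} \<Longrightarrow> N $$ (i - 1, 0) = N' $$ (i - 1, 0)"
    and rec: "\<And>i. i \<in> {k..n} \<Longrightarrow> N $$ (i - 1, 0) = - (\<Sum>j=1..k-1. x j * N $$ (i - k + j - 1, 0)) / x k"
    and rec': "\<And>i. i \<in> {k..n} \<Longrightarrow> N' $$ (i - 1, 0) = - (\<Sum>j=1..k-1. x j * N' $$ (i - k + j - 1, 0)) / x k"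
  shows "N = N'"
proof (rule circulant_eqI[OF assms(1,2)])
  show "N $$ (r, 0) = N' $$ (r, 0)" if "r < n" for r
    using that
  proof (induction r rule: less_induct)
    case (less r)
    show ?case
    proof (cases "r < k - 1")
      case True
      then show ?thesis using assms(4)[of "Suc r"] by simp
    next
      case False
      then have "(\<Sum>j=1..k-1. x j * N $$ (Suc r - k + j - 1, 0))
          = (\<Sum>j=1..k-1. x j * N' $$ (Suc r - k + j - 1, 0))"
        using less.prems by (intro sum.cong refl) (auto intro!: less.IH)
      then show ?thesis using rec[of "Suc r"] rec'[of "Suc r"] False less.prems by simp
    qed
  qed
qed

section \<open>Recurrent sequences and shifts of their windows\<close>

definition recurrent :: "nat \<Rightarrow> (nat \<Rightarrow> 'a::field) \<Rightarrow> (nat \<Rightarrow> 'a) \<Rightarrow> bool" where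
  "recurrent k x z \<longleftrightarrow> (\<forall>t. (\<Sum>j<k. x (Suc j) * z (t + j)) = 0)"

text \<open>Continues \<open>k - 1\<close> given values to a recurrent sequence on all natural
  numbers. Shifts by n can then be applied to a vector without reducing indices modulo n.\<close>

function recurrence :: "nat \<Rightarrow> (nat \<Rightarrow> 'a::field) \<Rightarrow> (nat \<Rightarrow> 'a) \<Rightarrow> nat \<Rightarrow> 'a" where
  "recurrence k x w t = (if t < k - 1 then w t
     else - (\<Sum>j\<in>{..<k-1}. x (Suc j) * recurrence k x w (t - (k - 1) + j)) / x k)"
  by pat_completeness auto
termination by (relation "measure (\<lambda>(k, x, w, t). t)") auto

declare recurrence.simps [simp del]

lemma recurrence_initial: "t < k - 1 \<Longrightarrow> recurrence k x w t = w t"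
  by (simp add: recurrence.simps)

lemma sum_x_split:
  assumes "1 \<le> k"
  shows "(\<Sum>j<k. x (Suc j) * z (t + j)) = (\<Sum>j<k-1. x (Suc j) * z (t + j)) + (x k :: 'a::field) * z (t + (k - 1))"
  using assms by (cases k) auto

lemma recurrent_recurrence:
  assumes "1 \<le> k" "x k \<noteq> 0"
  shows "recurrent k x (recurrence k x w)"
  unfolding recurrent_def
proof
  fix t
  have "recurrence k x w (t + (k - 1)) = - (\<Sum>j<k-1. x (Suc j) * recurrence k x w (t + j)) / x k"
    by (subst recurrence.simps) simp
  then show "(\<Sum>j<k. x (Suc j) * recurrence k x w (t + j)) = 0"
    using assms by (simp add: sum_x_split)
qed

lemma recurrentD:
  assumes "recurrent k x z" "1 \<le> k" "x k \<noteq> 0"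
  shows "z (t + (k - 1)) = - (\<Sum>j<k-1. x (Suc j) * z (t + j)) / x k"
proof -
  have "(\<Sum>j<k-1. x (Suc j) * z (t + j)) + x k * z (t + (k - 1)) = 0"
    using assms(1) unfolding recurrent_def sum_x_split[OF assms(2)] by blast
  then have "z (t + (k - 1)) * x k = - (\<Sum>j<k-1. x (Suc j) * z (t + j))"
    by (metis add.commute eq_neg_iff_add_eq_0 mult.commute)
  then show ?thesis using assms(3) by (metis nonzero_eq_divide_eq)
qed

text \<open>The matrices that agree with the \<open>q\<close>-th power of the companion matrix on windows of recurrent
  sequences.\<close>

definition shift_matrix :: "nat \<Rightarrow> (nat \<Rightarrow> 'a::field) \<Rightarrow> nat \<Rightarrow> (nat \<Rightarrow> nat \<Rightarrow> 'a) \<Rightarrow> bool" where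
  "shift_matrix k x q a \<longleftrightarrow>
     (\<forall>z. recurrent k x z \<longrightarrow> (\<forall>t. \<forall>i<k-1. z (t + q + i) = (\<Sum>j<k-1. a i j * z (t + j))))"

lemma shift_matrix_0:
  assumes "\<And>i j. i < k - 1 \<Longrightarrow> j < k - 1 \<Longrightarrow> a i j = (if i = j then 1 else 0)"
  shows "shift_matrix k x 0 a"
  unfolding shift_matrix_def
proof (intro allI impI)
  fix z t i assume "i < k - 1"
  have "(\<Sum>j<k-1. a i j * z (t + j)) = (\<Sum>j<k-1. if i = j then z (t + j) else 0)"
    using assms \<open>i < k - 1\<close> by (intro sum.cong) auto
  then show "z (t + 0 + i) = (\<Sum>j<k-1. a i j * z (t + j))" using \<open>i < k - 1\<close> by simp
qed

lemma shift_matrix_square: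
  assumes a: "shift_matrix k x q a"
    and b: "\<And>i j. i < k - 1 \<Longrightarrow> j < k - 1 \<Longrightarrow> b i j = (\<Sum>l<k-1. a i l * a l j)"
  shows "shift_matrix k x (2 * q) b"
  unfolding shift_matrix_def
proof (intro allI impI)
  fix z t i assume z: "recurrent k x z" and i: "i < k - 1"
  have *: "z (t + q + l) = (\<Sum>j<k-1. a l j * z (t + j))" if "l < k - 1" for l t
    using a z that by (simp add: shift_matrix_def)
  have "z (t + 2 * q + i) = z ((t + q) + q + i)" by (rule arg_cong[of _ _ z]) simp
  also have "\<dots> = (\<Sum>l<k-1. a i l * (\<Sum>j<k-1. a l j * z (t + j)))"
    unfolding *[OF i] by (intro sum.cong) (auto simp: *)
  also have "\<dots> = (\<Sum>j<k-1. \<Sum>l<k-1. a i l * (a l j * z (t + j)))"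
    unfolding sum_distrib_left by (rule sum.swap)
  also have "\<dots> = (\<Sum>j<k-1. b i j * z (t + j))"
    using i by (intro sum.cong) (auto simp: b sum_distrib_right mult.assoc)
  finally show "z (t + 2 * q + i) = (\<Sum>j<k-1. b i j * z (t + j))" .
qed

text \<open>Multiplication by the companion matrix from the right: in the window that starts at
  \<open>t + 1\<close> only the last term lies outside the window at \<open>t\<close>, and the
  recurrence expresses it by that window. A step thus needs O(k^2) operations instead of a matrix
  product.\<close>

lemma shift_matrix_Suc:
  assumes k: "2 \<le> k" and xk: "x k \<noteq> 0" and a: "shift_matrix k x q a"
    and b: "\<And>i j. i < k - 1 \<Longrightarrow> j < k - 1 \<Longrightarrow>
      b i j = (if 0 < j then a i (j - 1) else 0) - a i (k - 2) * (x (j + 1) / x k)"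
  shows "shift_matrix k x (Suc q) b"
  unfolding shift_matrix_def
proof (intro allI impI)
  fix z t i assume z: "recurrent k x z" and i: "i < k - 1"
  obtain m where m: "k = Suc (Suc m)" using k by (metis Suc_eq_plus1 add_2_eq_Suc le_Suc_ex)
  have rec: "z (Suc t + m) = - (\<Sum>j<Suc m. x (Suc j) * z (t + j)) / x k"
    using recurrentD[OF z _ xk, of t] by (simp add: m)
  have "z (t + Suc q + i) = z (Suc t + q + i)" by simp
  also have "\<dots> = (\<Sum>j<Suc m. a i j * z (Suc t + j))"
    using a z i m unfolding shift_matrix_def by (metis diff_Suc_1)
  also have "\<dots> = (\<Sum>j<m. a i j * z (Suc t + j)) + a i m * z (Suc t + m)" by simp
  also have "(\<Sum>j<m. a i j * z (Suc t + j)) = (\<Sum>j<Suc m. (if 0 < j then a i (j - 1) else 0) * z (t + j))"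
    unfolding sum.lessThan_Suc_shift by simp
  also have "a i m * z (Suc t + m) = (\<Sum>j<Suc m. - (a i m * (x (j + 1) / x k)) * z (t + j))"
    unfolding rec by (simp only: sum_divide_distrib sum_negf[symmetric] sum_distrib_left)
      (auto intro!: sum.cong simp: field_simps xk)
  also have "(\<Sum>j<Suc m. (if 0 < j then a i (j - 1) else 0) * z (t + j)) + \<dots>
      = (\<Sum>j<Suc m. b i j * z (t + j))"
    unfolding sum.distrib[symmetric] using i
    by (intro sum.cong) (auto simp: b m algebra_simps)
  finally show "z (t + Suc q + i) = (\<Sum>j<k-1. b i j * z (t + j))" by (simp add: m)
qed

section \<open>The linear system for the initial terms\<close>

text \<open>\<open>S\<close> has \<open>m\<close> rows and \<open>m + 1\<close> columns: the augmented system \<open>(A | b)\<close> has the solution \<open>y\<close> iff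
  \<open>(y, -1)\<close> is in its null space, and row operations preserve the null space.\<close>

definition null_space :: "nat \<Rightarrow> (nat \<Rightarrow> nat \<Rightarrow> 'a::field) \<Rightarrow> (nat \<Rightarrow> 'a) set" where
  "null_space m S = {w. \<forall>i<m. (\<Sum>j<Suc m. S i j * w j) = 0}"

lemma inverse_in_null_space:
  fixes x :: "nat \<Rightarrow> 'a::field"
  assumes k: "2 \<le> k" "k \<le> n" and xk: "x k \<noteq> 0"
    and N: "N \<in> carrier_mat n n" "inverts_mat (diag_circulant n k x) N"
    and a: "shift_matrix k x n a"
    and S: "\<And>i j. i < k - 1 \<Longrightarrow> j < k - 1 \<Longrightarrow> S i j = (if i = j then 1 else 0) - a i j"
      "\<And>i. i < k - 1 \<Longrightarrow> S i (k - 1) = (if i = k - 2 then 1 / x k else 0)"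
  shows "(\<lambda>j. if j < k - 1 then N $$ (j, 0) else -1) \<in> null_space (k - 1) S"
proof -
  define y where "y = (\<lambda>t. N $$ (t, 0))"
  define z where "z = recurrence k x y"
  \<comment> \<open>The periodic extension of \<open>y\<close> minus the recurrent continuation of
    the same initial values. Row \<open>i\<close> of (I - R^n) y equals
    \<open>y i - z (n + i)\<close>, which is \<open>d (n + i)\<close>, so the right-hand side of the
    system consists of values of \<open>d\<close>.\<close>
  define d where "d = (\<lambda>t. y (t mod n) - z t)"
  have n: "0 < n" and k1: "1 \<le> k" using k by simp_all
  have z: "recurrent k x z" unfolding z_def using k1 xk by (rule recurrent_recurrence)
  have d_sum: "(\<Sum>j<k. x (Suc j) * d (t + j)) = (if (t + 1) mod n = 0 then 1 else 0)" for t
    using z inverse_diag_circulant_cyclic_recursion[OF k N n, of t]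
    by (simp add: recurrent_def d_def y_def right_diff_distrib sum_subtractf)
  have d_init: "d t = 0" if "t < k - 1" for t
    using that k by (simp add: d_def z_def recurrence_initial)
  have d_0: "d t = 0" if "t < n + (k - 2)" for t
    using that
  proof (induction t rule: less_induct)
    case (less t)
    show ?case
    proof (cases "t < k - 1")
      case False
      have "(\<Sum>j<k-1. x (Suc j) * d (t - (k - 1) + j)) = 0"
        using False less.prems by (intro sum.neutral) (auto intro!: less.IH)
      moreover have "t - (k - 1) + 1 < n" using False less.prems k by linarith
      ultimately have "x k * d (t - (k - 1) + (k - 1)) = 0"
        using d_sum[of "t - (k - 1)"] unfolding sum_x_split[OF k1] by simp
      then show ?thesis using False xk by simp
    qed (rule d_init)
  qed
  \<comment> \<open>The recurrence for \<open>y\<close> first fails at \<open>t = n - 1\<close>,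
    which is row 0 of M N = I. Its highest index is \<open>n + (k - 2)\<close>, the first place
    where \<open>d\<close> can be nonzero.\<close>
  have "x k * d (n + (k - 2)) = 1"
  proof -
    have "(\<Sum>j<k-1. x (Suc j) * d (n - 1 + j)) = 0"
      using n k by (intro sum.neutral) (auto intro!: d_0)
    moreover have "n - 1 + (k - 1) = n + (k - 2)" using n k by linarith
    ultimately show ?thesis using d_sum[of "n - 1", unfolded sum_x_split[OF k1]] n
      by (simp add: numeral_2_eq_2)
  qed
  then have d_last: "d (n + (k - 2)) = 1 / x k" using xk by (simp add: field_simps)
  show ?thesis
    unfolding null_space_def
  proof (safe)
    fix i assume i: "i < k - 1"
    have "(\<Sum>j<Suc (k - 1). S i j * (if j < k - 1 then N $$ (j, 0) else -1))
        = (\<Sum>j<k-1. S i j * y j) - S i (k - 1)"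
      by (simp add: y_def)
    also have "(\<Sum>j<k-1. S i j * y j) = (\<Sum>j<k-1. (if i = j then y j else 0) - a i j * z j)"
      using i by (intro sum.cong) (auto simp: S z_def recurrence_initial algebra_simps)
    also have "\<dots> = y i - (\<Sum>j<k-1. a i j * z (0 + j))"
      using i by (simp add: sum_subtractf)
    also have "(\<Sum>j<k-1. a i j * z (0 + j)) = z (0 + n + i)"
      using a z i unfolding shift_matrix_def by metis
    also have "y i - z (0 + n + i) = d (n + i)"
      using i k by (simp add: d_def)
    also have "\<dots> = S i (k - 1)"
    proof (cases "i = k - 2")
      case True
      then show ?thesis using i d_last by (simp only: S) simp
    next
      case False
      then have "n + i < n + (k - 2)" using i by linarith
      then show ?thesis using i False d_0[of "n + i"] S(2)[OF i] by simp
    qed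
    finally show "(\<Sum>j<Suc (k - 1). S i j * (if j < k - 1 then N $$ (j, 0) else -1)) = 0" by simp
  qed
qed

text \<open>The last coordinate multiplies the right-hand side, so \<open>w (k - 1) = 0\<close>
  singles out the homogeneous solutions. This is the injectivity of I - R^n, from which every pivot
  of the elimination is obtained.\<close>

lemma null_space_trivial:
  fixes x :: "nat \<Rightarrow> 'a::field"
  assumes k: "2 \<le> k" "k \<le> n" and xk: "x k \<noteq> 0"
    and N: "N \<in> carrier_mat n n" "inverts_mat N (diag_circulant n k x)"
    and a: "shift_matrix k x n a"
    and S: "\<And>i j. i < k - 1 \<Longrightarrow> j < k - 1 \<Longrightarrow> S i j = (if i = j then 1 else 0) - a i j"
    and w: "w \<in> null_space (k - 1) S" "w (k - 1) = 0" and j: "j < k - 1"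
  shows "w j = 0"
proof -
  let ?M = "diag_circulant n k x"
  define z where "z = recurrence k x w"
  have n: "0 < n" and k1: "1 \<le> k" using k by simp_all
  have z: "recurrent k x z" unfolding z_def using k1 xk by (rule recurrent_recurrence)
  have init: "z (t + n) = z t" if t: "t < k - 1" for t
  proof -
    have "(\<Sum>j<Suc (k - 1). S t j * w j) = 0"
      using w(1) t unfolding null_space_def by blast
    then have "0 = (\<Sum>j<k-1. S t j * w j)" unfolding sum.lessThan_Suc w(2) by simp
    also have "\<dots> = (\<Sum>j<k-1. (if t = j then w j else 0) - a t j * z j)"
      using t by (intro sum.cong) (auto simp: S z_def recurrence_initial algebra_simps)
    also have "\<dots> = z t - (\<Sum>j<k-1. a t j * z (0 + j))"
      using t by (simp add: sum_subtractf z_def recurrence_initial)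
    also have "(\<Sum>j<k-1. a t j * z (0 + j)) = z (0 + n + t)"
      using a z t unfolding shift_matrix_def by metis
    finally show ?thesis by (simp add: add.commute)
  qed
  \<comment> \<open>Each later term is determined by the \<open>k - 1\<close> terms before it, so
    agreement on one window propagates.\<close>
  have per: "z (t + n) = z t" for t
  proof (induction t rule: less_induct)
    case (less t)
    show ?case
    proof (cases "t < k - 1")
      case False
      have "(\<Sum>j<k-1. x (Suc j) * z (t - (k - 1) + n + j))
          = (\<Sum>j<k-1. x (Suc j) * z (t - (k - 1) + j))"
      proof (intro sum.cong refl)
        fix j assume "j \<in> {..<k - 1}"
        then have "z ((t - (k - 1) + j) + n) = z (t - (k - 1) + j)"
          using False by (intro less.IH) auto
        then show "x (Suc j) * z (t - (k - 1) + n + j) = x (Suc j) * z (t - (k - 1) + j)"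
          by (simp add: ac_simps)
      qed
      then have "z (t - (k - 1) + n + (k - 1)) = z (t - (k - 1) + (k - 1))"
        unfolding recurrentD[OF z k1 xk] by simp
      then show ?thesis using False by simp
    qed (rule init)
  qed
  have mod: "z (t mod n) = z t" for t
  proof (induction t rule: less_induct)
    case (less t)
    show ?case
    proof (cases "t < n")
      case False
      then have "z (t mod n) = z ((t - n) mod n)" by (simp add: le_mod_geq)
      also have "\<dots> = z (t - n)" using False n by (intro less.IH) simp
      also have "\<dots> = z t" using per[of "t - n"] False by simp
      finally show ?thesis .
    qed simp
  qed
  define v where "v = vec n z"
  have v: "v \<in> carrier_vec n" by (simp add: v_def)
  have "?M *\<^sub>v v = 0\<^sub>v n"
  proof (rule eq_vecI)
    fix r assume "r < dim_vec (0\<^sub>v n :: 'a vec)"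
    then have rn: "r < n" by simp
    obtain t where r: "r = (t + 1) mod n" using Suc_mod_surj[OF rn] .
    have "(?M *\<^sub>v v) $ r = (\<Sum>j<k. x (Suc j) * v $ ((t + j) mod n))"
      unfolding r by (rule mult_mat_vec_diag_circulant[OF k]) (simp add: v_def)
    also have "\<dots> = 0" using z n by (simp add: v_def mod recurrent_def)
    finally show "(?M *\<^sub>v v) $ r = 0\<^sub>v n $ r" using rn by simp
  qed (simp add: diag_circulant_def)
  then have "N *\<^sub>v (?M *\<^sub>v v) = 0\<^sub>v n" using N(1) by (intro eq_vecI) auto
  moreover have "N *\<^sub>v (?M *\<^sub>v v) = (N * ?M) *\<^sub>v v"
    using assoc_mult_mat_vec[OF N(1) diag_circulant_carrier v] by simp
  moreover have "\<dots> = v" using N v by (simp add: inverts_mat_def)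
  ultimately have "v = 0\<^sub>v n" by simp
  then have "z j = 0" using j k by (metis v_def index_vec index_zero_vec(1) less_le_trans less_imp_diff_less diff_le_self)
  then show ?thesis using j by (simp add: z_def recurrence_initial)
qed

section \<open>Reasoning about programs\<close>

text \<open>Total correctness: the result has to be \<open>Some\<close>, so a proof also shows that
  no division by zero occurs.\<close>

definition wp :: "prog \<Rightarrow> (nat \<Rightarrow> nat) \<Rightarrow> ('a::field store \<Rightarrow> nat \<Rightarrow> bool) \<Rightarrow> 'a store \<Rightarrow> nat \<Rightarrow> bool" where
  "wp P env Q s t \<longleftrightarrow> (\<exists>s' t'. exec P env (s, t) = Some (s', t') \<and> Q s' t')"

lemma wp_simps [simp]:
  "wp Skip env Q s t \<longleftrightarrow> Q s t"
  "wp (SetZero d) env Q s t \<longleftrightarrow> Q (s(address env d := 0)) t"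
  "wp (SetOne d) env Q s t \<longleftrightarrow> Q (s(address env d := 1)) t"
  "wp (Copy d a) env Q s t \<longleftrightarrow> Q (s(address env d := s (address env a))) t"
  "wp (Op FAdd d a b) env Q s t \<longleftrightarrow> Q (s(address env d := s (address env a) + s (address env b))) (Suc t)"
  "wp (Op FSub d a b) env Q s t \<longleftrightarrow> Q (s(address env d := s (address env a) - s (address env b))) (Suc t)"
  "wp (Op FMul d a b) env Q s t \<longleftrightarrow> Q (s(address env d := s (address env a) * s (address env b))) (Suc t)"
  "wp (Op FDiv d a b) env Q s t \<longleftrightarrow> s (address env b) \<noteq> 0 \<and>
     Q (s(address env d := s (address env a) / s (address env b))) (Suc t)"
  "wp (Seq p q) env Q s t \<longleftrightarrow> wp p env (wp q env Q) s t"
  "wp (IfLess e f p q) env Q s t \<longleftrightarrow>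
     (if index_val env e < index_val env f then wp p env Q s t else wp q env Q s t)"
  "wp (IfZero a p q) env Q s t \<longleftrightarrow>
     (if s (address env a) = 0 then wp p env Q s (Suc t) else wp q env Q s (Suc t))"
  by (auto simp: wp_def bind_eq_Some_conv)

lemma wp_mono:
  assumes "wp P env Q s t" "\<And>s' t'. Q s' t' \<Longrightarrow> R s' t'"
  shows "wp P env R s t"
  using assms unfolding wp_def by blast

lemma wp_For:
  assumes body: "\<And>i s t. i < index_val env e \<Longrightarrow> J i s t \<Longrightarrow> wp p (env(v := i)) (J (Suc i)) s t"
    and init: "J 0 s t" and final: "\<And>s t. J (index_val env e) s t \<Longrightarrow> Q s t"
  shows "wp (For v e p) env Q s t"
proof -
  have "\<exists>s' t'. fold (\<lambda>i r. Option.bind r (exec p (env(v := i)))) [0..<l] (Some (s, t))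
      = Some (s', t') \<and> J l s' t'" if "l \<le> index_val env e" for l
    using that
  proof (induction l)
    case 0
    then show ?case using init by simp
  next
    case (Suc l)
    then obtain s' t' where
      l: "fold (\<lambda>i r. Option.bind r (exec p (env(v := i)))) [0..<l] (Some (s, t)) = Some (s', t')"
      and "J l s' t'" using Suc.IH[OF Suc_leD[OF Suc.prems]] by blast
    then have "wp p (env(v := l)) (J (Suc l)) s' t'" using body[of l s' t'] Suc.prems by simp
    then show ?case
      unfolding upt_Suc_append[OF le0] fold_append comp_def l by (auto simp: wp_def)
  qed
  from this[of "index_val env e"] show ?thesis
    using final by (auto simp: wp_def)
qed

text \<open>Quantifying over the time \<open>t\<close> already spent makes the bound relative, so
  that bounds of consecutive programs simply add up.\<close>

definition runs :: "prog \<Rightarrow> (nat \<Rightarrow> nat) \<Rightarrow> 'a::field store \<Rightarrow> nat \<Rightarrow> ('a store \<Rightarrow> bool) \<Rightarrow> bool" where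
  "runs P env s c Q \<longleftrightarrow> (\<forall>t. wp P env (\<lambda>s' t'. Q s' \<and> t' \<le> t + c) s t)"

lemma runs_mono:
  assumes "runs P env s c Q" "\<And>s'. Q s' \<Longrightarrow> R s'" "c \<le> d"
  shows "runs P env s d R"
  unfolding runs_def
proof
  show "wp P env (\<lambda>s' t'. R s' \<and> t' \<le> t + d) s t" for t
    using assms(1)[unfolded runs_def, rule_format, of t] by (rule wp_mono) (use assms(2,3) in auto)
qed

lemma runs_Seq:
  assumes "runs p env s c Q" "\<And>s'. Q s' \<Longrightarrow> runs q env s' d R"
  shows "runs (Seq p q) env s (c + d) R"
  unfolding runs_def
proof
  show "wp (Seq p q) env (\<lambda>s' t'. R s' \<and> t' \<le> t + (c + d)) s t" for t
    unfolding wp_simps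
  proof (rule wp_mono[OF assms(1)[unfolded runs_def, rule_format, of t]])
    fix s' t' assume *: "Q s' \<and> t' \<le> t + c"
    then have "wp q env (\<lambda>s'' t''. R s'' \<and> t'' \<le> t' + d) s' t'"
      using assms(2) by (simp add: runs_def)
    then show "wp q env (\<lambda>s'' t''. R s'' \<and> t'' \<le> t + (c + d)) s' t'"
      by (rule wp_mono) (use * in auto)
  qed
qed

text \<open>The cost may vary with the iteration, as is needed for binary exponentiation, where the
  leading zeros of n must be free.\<close>

lemma runs_For_sum:
  assumes "\<And>i s. i < index_val env e \<Longrightarrow> J i s \<Longrightarrow> runs p (env(v := i)) s (c i) (J (Suc i))"
    and "J 0 s"
  shows "runs (For v e p) env s (\<Sum>i<index_val env e. c i) (J (index_val env e))"
  unfolding runs_def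
proof
  fix t
  show "wp (For v e p) env (\<lambda>s' t'. J (index_val env e) s' \<and> t' \<le> t + (\<Sum>i<index_val env e. c i)) s t"
  proof (rule wp_For[where J = "\<lambda>l s' t'. J l s' \<and> t' \<le> t + (\<Sum>i<l. c i)"])
    fix i s u assume i: "i < index_val env e" and *: "J i s \<and> u \<le> t + (\<Sum>i<i. c i)"
    then have "wp p (env(v := i)) (\<lambda>s' t'. J (Suc i) s' \<and> t' \<le> u + c i) s u"
      using assms(1) by (simp add: runs_def)
    then show "wp p (env(v := i)) (\<lambda>s' t'. J (Suc i) s' \<and> t' \<le> t + (\<Sum>i<Suc i. c i)) s u"
      by (rule wp_mono) (use * in auto)
  qed (use assms(2) in auto)
qed

lemma runs_For:
  assumes "\<And>i s. i < index_val env e \<Longrightarrow> J i s \<Longrightarrow> runs p (env(v := i)) s c (J (Suc i))"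
    and "J 0 s"
  shows "runs (For v e p) env s (index_val env e * c) (J (index_val env e))"
  using runs_For_sum[where c = "\<lambda>_. c", of env e J p v s] assms by simp

lemma runs_IfLess:
  assumes "index_val env a < index_val env b \<Longrightarrow> runs p env s c Q"
    and "\<not> index_val env a < index_val env b \<Longrightarrow> runs q env s c Q"
  shows "runs (IfLess a b p q) env s c Q"
  using assms by (simp add: runs_def)

lemma runs_IfZero:
  assumes "s (address env a) = 0 \<Longrightarrow> runs p env s c Q"
    and "s (address env a) \<noteq> 0 \<Longrightarrow> runs q env s c Q"
  shows "runs (IfZero a p q) env s (Suc c) Q"
  unfolding runs_def wp_simps
proof (intro allI)
  fix t
  have "wp p env (\<lambda>s' t'. Q s' \<and> t' \<le> t + Suc c) s (Suc t)" if "s (address env a) = 0"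
    using assms(1)[OF that, unfolded runs_def, rule_format, of "Suc t"] by (rule wp_mono) auto
  moreover have "wp q env (\<lambda>s' t'. Q s' \<and> t' \<le> t + Suc c) s (Suc t)" if "s (address env a) \<noteq> 0"
    using assms(2)[OF that, unfolded runs_def, rule_format, of "Suc t"] by (rule wp_mono) auto
  ultimately show "if s (address env a) = 0 then wp p env (\<lambda>s' t'. Q s' \<and> t' \<le> t + Suc c) s (Suc t)
      else wp q env (\<lambda>s' t'. Q s' \<and> t' \<le> t + Suc c) s (Suc t)" by simp
qed

lemma address_simp [simp]: "address env (a, i, j) = (a, index_val env i, index_val env j)"
  by (simp add: address_def)

section \<open>Loops that fill a row or an array\<close>

text \<open>Array 4 is for scratch values, which are ignored when stores are compared.\<close>

definition sim :: "'a store \<Rightarrow> 'a store \<Rightarrow> bool" where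
  "sim s s' \<longleftrightarrow> (\<forall>a i j. a \<noteq> 4 \<longrightarrow> s (a, i, j) = s' (a, i, j))"

definition fill_row :: "nat \<Rightarrow> nat \<Rightarrow> nat \<Rightarrow> (nat \<Rightarrow> 'a) \<Rightarrow> 'a store \<Rightarrow> 'a store" where
  "fill_row b r m f s = (\<lambda>(a, i, j). if a = b \<and> i = r \<and> j < m then f j else s (a, i, j))"

definition fill :: "nat \<Rightarrow> nat \<Rightarrow> nat \<Rightarrow> (nat \<Rightarrow> nat \<Rightarrow> 'a) \<Rightarrow> 'a store \<Rightarrow> 'a store" where
  "fill b l m f s = (\<lambda>(a, i, j). if a = b \<and> i < l \<and> j < m then f i j else s (a, i, j))"

lemma sim_refl [simp]: "sim s s"
  by (simp add: sim_def)

lemma runs_fill_row: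
  assumes "index_val env e = m" "sim s\<^sub>0 s"
    and body: "\<And>j s'. j < m \<Longrightarrow> sim s' (fill_row b r j f s) \<Longrightarrow>
      runs p (env(v := j)) s' c (\<lambda>s''. sim s'' ((fill_row b r j f s)((b, r, j) := f j)))"
  shows "runs (For v e p) env s\<^sub>0 (m * c) (\<lambda>s'. sim s' (fill_row b r m f s))"
proof -
  have Suc: "(fill_row b r j f s)((b, r, j) := f j) = fill_row b r (Suc j) f s" for j
    by (auto simp: fill_row_def fun_eq_iff less_Suc_eq)
  have "sim s\<^sub>0 (fill_row b r 0 f s)" using assms(2) by (simp add: sim_def fill_row_def)
  then show ?thesis
    using runs_For[where J = "\<lambda>j s'. sim s' (fill_row b r j f s)", of env e p v c] body assms(1)
    unfolding Suc by blast
qed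

text \<open>\<open>fill_row b i j (f i) (fill b i m f s)\<close> is the store after \<open>i\<close>
  complete rows and \<open>j\<close> entries of the next one. Since \<open>f\<close> is fixed before
  the loop, the premise on the body has to account for entries that are already overwritten.\<close>

lemma runs_fill:
  assumes "index_val env e = l" "\<And>i. i < l \<Longrightarrow> index_val (env(u := i)) e' = m" "sim s\<^sub>0 s"
    and body: "\<And>i j s'. i < l \<Longrightarrow> j < m \<Longrightarrow> sim s' (fill_row b i j (f i) (fill b i m f s)) \<Longrightarrow>
      runs p (env(u := i, v := j)) s' c
        (\<lambda>s''. sim s'' ((fill_row b i j (f i) (fill b i m f s))((b, i, j) := f i j)))"
  shows "runs (For u e (For v e' p)) env s\<^sub>0 (l * (m * c)) (\<lambda>s'. sim s' (fill b l m f s))"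
proof -
  have Suc: "fill_row b i m (f i) (fill b i m f s) = fill b (Suc i) m f s" for i
    by (auto simp: fill_row_def fill_def fun_eq_iff less_Suc_eq)
  have "runs (For v e' p) (env(u := i)) s' (m * c) (\<lambda>s'. sim s' (fill b (Suc i) m f s))"
    if "i < l" "sim s' (fill b i m f s)" for i s'
    unfolding Suc[symmetric] using assms(2)[OF that(1)] that(2) body[OF that(1)] by (rule runs_fill_row)
  moreover have "sim s\<^sub>0 (fill b 0 m f s)" using assms(3) by (simp add: sim_def fill_def)
  ultimately show ?thesis
    using runs_For[where J = "\<lambda>i s'. sim s' (fill b i m f s)", of env e "For v e' p" u "m * c"] assms(1)
    by blast
qed

section \<open>Programs for squaring and for one companion step\<close>

text \<open>Array 2 holds the current power of the companion matrix and array 3 its square.\<close>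

abbreviation (input) "k_minus_1 \<equiv> ISub (Var 1) (Num 1)"
abbreviation (input) "scratch \<equiv> (4::nat, Num 0, Num 0)"

definition square_prog :: prog where
  "square_prog = For 3 k_minus_1 (For 4 k_minus_1 (Seq (SetZero (3, Var 3, Var 4))
     (For 5 k_minus_1 (Seq (Op FMul scratch (2, Var 3, Var 5) (2, Var 5, Var 4))
        (Op FAdd (3, Var 3, Var 4) (3, Var 3, Var 4) scratch)))))"

definition copy_prog :: prog where
  "copy_prog = For 3 k_minus_1 (For 4 k_minus_1 (Copy (2, Var 3, Var 4) (3, Var 3, Var 4)))"

text \<open>The step of \<open>shift_matrix_Suc\<close>, leading from array 3 back to array 2.
  Column 0 has no left neighbour; as there is no negation, the difference is taken there from a cell
  set to 0.\<close>

definition shift_prog :: prog where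
  "shift_prog = For 3 k_minus_1 (For 4 k_minus_1
     (Seq (Op FDiv scratch (0, Num 0, IAdd (Var 4) (Num 1)) (0, Num 0, Var 1))
     (Seq (Op FMul scratch (3, Var 3, ISub (Var 1) (Num 2)) scratch)
     (IfLess (Num 0) (Var 4)
       (Op FSub (2, Var 3, Var 4) (3, Var 3, ISub (Var 4) (Num 1)) scratch)
       (Seq (SetZero (2, Var 3, Var 4)) (Op FSub (2, Var 3, Var 4) (2, Var 3, Var 4) scratch))))))"

lemma runs_square:
  assumes "env 1 = k"
  shows "runs square_prog env s ((k - 1) * ((k - 1) * ((k - 1) * 2)))
    (\<lambda>s'. sim s' (fill 3 (k - 1) (k - 1) (\<lambda>i j. \<Sum>l<k-1. s (2, i, l) * s (2, l, j)) s))"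
  unfolding square_prog_def
proof (rule runs_fill)
  fix i j s'
  define f where "f = (\<lambda>i j. \<Sum>l<k-1. s (2, i, l) * s (2, l, j))"
  define s1 where "s1 = fill_row 3 i j (f i) (fill 3 i (k - 1) f s)"
  let ?env = "env(3 := i, 4 := j)"
  let ?p = "Seq (Op FMul scratch (2, Var 3, Var 5) (2, Var 5, Var 4))
        (Op FAdd (3, Var 3, Var 4) (3, Var 3, Var 4) scratch)"
  define J where "J = (\<lambda>l s'. sim s' (s1((3, i, j) := \<Sum>l<l. s (2, i, l) * s (2, l, j))))"
  assume "sim s' (fill_row 3 i j (\<lambda>j. \<Sum>l<k-1. s (2, i, l) * s (2, l, j))
    (fill 3 i (k - 1) (\<lambda>i j. \<Sum>l<k-1. s (2, i, l) * s (2, l, j)) s))"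
  then have s': "sim s' s1" by (simp add: s1_def f_def)
  have body: "runs ?p (?env(5 := l)) s'' 2 (J (Suc l))" if "J l s''" for l s''
    using that by (simp add: runs_def J_def sim_def s1_def fill_row_def fill_def)
  have "runs (Seq (SetZero (3, Var 3, Var 4)) (For 5 k_minus_1 ?p)) ?env s' (0 + (k - 1) * 2) (J (k - 1))"
  proof (rule runs_Seq)
    show "runs (SetZero (3, Var 3, Var 4)) ?env s' 0 (J 0)"
      using s' by (simp add: runs_def J_def sim_def)
    fix s'' assume "J 0 s''"
    then show "runs (For 5 k_minus_1 ?p) ?env s'' ((k - 1) * 2) (J (k - 1))"
      using runs_For[where J = J, of ?env k_minus_1 ?p 5 2 s''] body assms by simp
  qed
  then show "runs (Seq (SetZero (3, Var 3, Var 4)) (For 5 k_minus_1 ?p)) ?env s' ((k - 1) * 2)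
    (\<lambda>s''. sim s'' ((fill_row 3 i j (\<lambda>j. \<Sum>l<k-1. s (2, i, l) * s (2, l, j))
    (fill 3 i (k - 1) (\<lambda>i j. \<Sum>l<k-1. s (2, i, l) * s (2, l, j)) s))
     ((3, i, j) := \<Sum>l<k-1. s (2, i, l) * s (2, l, j))))"
    by (simp add: J_def s1_def f_def)
qed (use assms in auto)

lemma runs_copy:
  assumes "env 1 = k" "sim s\<^sub>0 s"
  shows "runs copy_prog env s\<^sub>0 0 (\<lambda>s'. sim s' (fill 2 (k - 1) (k - 1) (\<lambda>i j. s (3, i, j)) s))"
proof -
  have "runs copy_prog env s\<^sub>0 ((k - 1) * ((k - 1) * 0))
      (\<lambda>s'. sim s' (fill 2 (k - 1) (k - 1) (\<lambda>i j. s (3, i, j)) s))"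
    unfolding copy_prog_def
    by (rule runs_fill) (use assms in \<open>auto simp: runs_def sim_def fill_row_def fill_def\<close>)
  then show ?thesis by simp
qed

lemma runs_shift:
  assumes "env 1 = k" "sim s\<^sub>0 s" "s (0, 0, k) \<noteq> 0"
  shows "runs shift_prog env s\<^sub>0 ((k - 1) * ((k - 1) * 3))
    (\<lambda>s'. sim s' (fill 2 (k - 1) (k - 1) (\<lambda>i j. (if 0 < j then s (3, i, j - 1) else 0)
       - s (3, i, k - 2) * (s (0, 0, j + 1) / s (0, 0, k))) s))"
  unfolding shift_prog_def
  by (rule runs_fill) (use assms in \<open>auto simp: runs_def sim_def fill_row_def fill_def\<close>)

section \<open>Powers of the companion matrix and the linear system\<close>

definition diag_prog :: "nat \<Rightarrow> prog" where
  "diag_prog b = For 2 k_minus_1 (SetOne (b, Var 2, Var 2))"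

lemma runs_diag:
  assumes "env 1 = k"
  shows "runs (diag_prog b) env s 0
    (\<lambda>s'. s' = (\<lambda>(a, i, j). if a = b \<and> i = j \<and> i < k - 1 then 1 else s (a, i, j)))"
proof -
  define J where "J = (\<lambda>l s'. s' = (\<lambda>(a, i, j). if a = b \<and> i = j \<and> i < l then 1 else s (a, i, j)))"
  have "runs (SetOne (b, Var 2, Var 2)) (env(2 := i)) s' 0 (J (Suc i))" if "J i s'" for i :: nat and s'
    using that by (auto simp: runs_def J_def fun_eq_iff)
  moreover have "J 0 s" by (auto simp: J_def)
  ultimately have "runs (diag_prog b) env s ((k - 1) * 0) (J (k - 1))"
    using runs_For[where J = J, of env k_minus_1 "SetOne (b, Var 2, Var 2)" 2 0 s] assms
    by (simp add: diag_prog_def)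
  then show ?thesis by (simp add: J_def)
qed

text \<open>The leading bits of \<open>n\<close> are processed from the left. Since there is no logarithm among the index
  expressions, the loop also runs through the leading zeros, for which it spends no operation.\<close>

definition power_prog :: prog where
  "power_prog = For 2 (Var 0)
     (IfLess (Num 0) (IDiv (Var 0) (IPow (Num 2) (ISub (Var 0) (IAdd (Var 2) (Num 1)))))
       (Seq square_prog
         (IfLess (IMul (Num 2) (IDiv (Var 0) (IPow (Num 2) (ISub (Var 0) (Var 2)))))
           (IDiv (Var 0) (IPow (Num 2) (ISub (Var 0) (IAdd (Var 2) (Num 1)))))
           shift_prog copy_prog))
       Skip)"

text \<open>Array 5 has to remain zero because \<open>system_prog\<close> writes only a diagonal,
  and one entry of the last column, before relying on the other entries.\<close>

definition holds_input :: "nat \<Rightarrow> (nat \<Rightarrow> 'a::field) \<Rightarrow> 'a store \<Rightarrow> bool" where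
  "holds_input k x s \<longleftrightarrow> (\<forall>j\<in>{1..k}. s (0, 0, j) = x j) \<and> (\<forall>i j. s (5, i, j) = 0)"

lemma holds_input_sim: "sim s s' \<Longrightarrow> holds_input k x s' \<Longrightarrow> holds_input k x s"
  by (simp add: holds_input_def sim_def)

lemma holds_input_fill: "b \<noteq> 0 \<Longrightarrow> b \<noteq> 5 \<Longrightarrow> holds_input k x (fill b l m f s) \<longleftrightarrow> holds_input k x s"
  by (simp add: holds_input_def fill_def)

lemma runs_power:
  fixes x :: "nat \<Rightarrow> 'a::field"
  assumes k: "2 \<le> k" and xk: "x k \<noteq> 0" and env: "env 0 = n" "env 1 = k"
    and s: "holds_input k x s" "shift_matrix k x 0 (\<lambda>i j. s (2, i, j))"
  shows "runs power_prog env s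
    (\<Sum>v<n. if 0 < n div 2 ^ (n - Suc v) then 5 * k ^ 3 else 0)
    (\<lambda>s'. holds_input k x s' \<and> shift_matrix k x n (\<lambda>i j. s' (2, i, j)))"
proof -
  \<comment> \<open>\<open>n div 2 ^ (n - v)\<close> is the number formed by the binary digits of n
    read before iteration \<open>v\<close>, when n is padded to n digits.\<close>
  define J where "J = (\<lambda>v s. holds_input k x s \<and> shift_matrix k x (n div 2 ^ (n - v)) (\<lambda>i j. s (2, i, j)))"
  define p where "p = IfLess (Num 0) (IDiv (Var 0) (IPow (Num 2) (ISub (Var 0) (IAdd (Var 2) (Num 1)))))
       (Seq square_prog
         (IfLess (IMul (Num 2) (IDiv (Var 0) (IPow (Num 2) (ISub (Var 0) (Var 2)))))
           (IDiv (Var 0) (IPow (Num 2) (ISub (Var 0) (IAdd (Var 2) (Num 1)))))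
           shift_prog copy_prog)) Skip"
  have body: "runs p (env(2 := v)) s (if 0 < n div 2 ^ (n - Suc v) then 5 * k ^ 3 else 0) (J (Suc v))"
    if v: "v < n" and J: "J v s" for v s
  proof -
    define q' where "q' = n div 2 ^ (n - Suc v)"
    define q where "q = n div 2 ^ (n - v)"
    have "n - v = Suc (n - Suc v)" using v by simp
    then have q: "q = q' div 2" by (simp only: q_def q'_def power_Suc2 div_mult2_eq)
    define sq where "sq = fill 3 (k - 1) (k - 1) (\<lambda>i j. \<Sum>l<k-1. s (2, i, l) * s (2, l, j)) s"
    have inp: "holds_input k x s" and sh: "shift_matrix k x q (\<lambda>i j. s (2, i, j))"
      using J by (simp_all add: J_def q_def)
    have sq_inp: "holds_input k x sq" using inp by (simp add: sq_def holds_input_fill)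
    have sq_sh: "shift_matrix k x (2 * q) (\<lambda>i j. sq (3, i, j))"
      using sh by (rule shift_matrix_square) (simp add: sq_def fill_def)
    have xk': "sq (0, 0, j) = x j" if "j \<in> {1..k}" for j using sq_inp that by (simp add: holds_input_def)
    \<comment> \<open>Two operations for each of the at most k^3 products in the square, and three
      for each entry of the companion step: this is the constant 5.\<close>
    have cost: "(k - 1) * ((k - 1) * ((k - 1) * 2)) + (k - 1) * ((k - 1) * 3) \<le> 5 * k ^ 3"
    proof -
      have "(k - 1) * ((k - 1) * ((k - 1) * 2)) \<le> k * (k * (k * 2))"
        by (intro mult_le_mono) auto
      moreover have "(k - 1) * ((k - 1) * 3) \<le> k * (k * (k * 3))"
        using k by (intro mult_le_mono) auto
      ultimately show ?thesis by (simp add: power3_eq_cube)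
    qed
    show ?thesis
      unfolding p_def
    proof (rule runs_IfLess)
      assume "index_val (env(2 := v)) (Num 0) < index_val (env(2 := v))
        (IDiv (Var 0) (IPow (Num 2) (ISub (Var 0) (IAdd (Var 2) (Num 1)))))"
      then have pos: "0 < n div 2 ^ (n - Suc v)" using env by simp
      have "runs (Seq square_prog
         (IfLess (IMul (Num 2) (IDiv (Var 0) (IPow (Num 2) (ISub (Var 0) (Var 2)))))
           (IDiv (Var 0) (IPow (Num 2) (ISub (Var 0) (IAdd (Var 2) (Num 1)))))
           shift_prog copy_prog)) (env(2 := v)) s
         ((k - 1) * ((k - 1) * ((k - 1) * 2)) + (k - 1) * ((k - 1) * 3)) (J (Suc v))"
      proof (rule runs_Seq)
        show "runs square_prog (env(2 := v)) s ((k - 1) * ((k - 1) * ((k - 1) * 2))) (\<lambda>s'. sim s' sq)"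
          unfolding sq_def using env by (intro runs_square) simp
        fix s' assume s': "sim s' sq"
        show "runs (IfLess (IMul (Num 2) (IDiv (Var 0) (IPow (Num 2) (ISub (Var 0) (Var 2)))))
           (IDiv (Var 0) (IPow (Num 2) (ISub (Var 0) (IAdd (Var 2) (Num 1)))))
           shift_prog copy_prog) (env(2 := v)) s' ((k - 1) * ((k - 1) * 3)) (J (Suc v))"
        proof (rule runs_IfLess)
          assume "index_val (env(2 := v)) (IMul (Num 2) (IDiv (Var 0) (IPow (Num 2) (ISub (Var 0) (Var 2)))))
            < index_val (env(2 := v)) (IDiv (Var 0) (IPow (Num 2) (ISub (Var 0) (IAdd (Var 2) (Num 1)))))"
          then have "2 * q < q'" using env by (simp add: q_def q'_def)
          \<comment> \<open>The next digit is 1, so the square has to be advanced by one more step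
            of the recurrence.\<close>
          then have q': "q' = Suc (2 * q)" using q by presburger
          define f where "f = (\<lambda>i j. (if 0 < j then sq (3, i, j - 1) else 0)
            - sq (3, i, k - 2) * (sq (0, 0, j + 1) / sq (0, 0, k)))"
          have "runs shift_prog (env(2 := v)) s' ((k - 1) * ((k - 1) * 3))
              (\<lambda>s''. sim s'' (fill 2 (k - 1) (k - 1) f sq))"
            unfolding f_def using env s' xk xk'[of k] k by (intro runs_shift) auto
          then show "runs shift_prog (env(2 := v)) s' ((k - 1) * ((k - 1) * 3)) (J (Suc v))"
          proof (rule runs_mono)
            fix s'' assume s'': "sim s'' (fill 2 (k - 1) (k - 1) f sq)"
            have "shift_matrix k x (Suc (2 * q)) (\<lambda>i j. s'' (2, i, j))"
              using k xk sq_sh by (rule shift_matrix_Suc) (use s'' xk' in \<open>simp add: sim_def fill_def f_def\<close>)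
            moreover have "holds_input k x s''"
              using s'' sq_inp by (intro holds_input_sim[OF s'']) (simp add: holds_input_fill)
            ultimately show "J (Suc v) s''" by (simp add: J_def q'[symmetric]) (simp add: q'_def)
          qed simp
        next
          assume "\<not> index_val (env(2 := v)) (IMul (Num 2) (IDiv (Var 0) (IPow (Num 2) (ISub (Var 0) (Var 2)))))
            < index_val (env(2 := v)) (IDiv (Var 0) (IPow (Num 2) (ISub (Var 0) (IAdd (Var 2) (Num 1)))))"
          then have "\<not> 2 * q < q'" using env by (simp add: q_def q'_def)
          then have q': "q' = 2 * q" using q by presburger
          have "runs copy_prog (env(2 := v)) s' 0
              (\<lambda>s''. sim s'' (fill 2 (k - 1) (k - 1) (\<lambda>i j. sq (3, i, j)) sq))"
            using env s' by (intro runs_copy) auto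
          then show "runs copy_prog (env(2 := v)) s' ((k - 1) * ((k - 1) * 3)) (J (Suc v))"
          proof (rule runs_mono)
            fix s'' assume s'': "sim s'' (fill 2 (k - 1) (k - 1) (\<lambda>i j. sq (3, i, j)) sq)"
            have "shift_matrix k x (2 * q) (\<lambda>i j. s'' (2, i, j))"
              using sh by (rule shift_matrix_square) (use s'' in \<open>simp add: sim_def fill_def sq_def\<close>)
            moreover have "holds_input k x s''"
              using s'' sq_inp by (intro holds_input_sim[OF s'']) (simp add: holds_input_fill)
            ultimately show "J (Suc v) s''" by (simp add: J_def q'[symmetric]) (simp add: q'_def)
          qed simp
        qed
      qed
      then show "runs (Seq square_prog
         (IfLess (IMul (Num 2) (IDiv (Var 0) (IPow (Num 2) (ISub (Var 0) (Var 2)))))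
           (IDiv (Var 0) (IPow (Num 2) (ISub (Var 0) (IAdd (Var 2) (Num 1)))))
           shift_prog copy_prog)) (env(2 := v)) s
         (if 0 < n div 2 ^ (n - Suc v) then 5 * k ^ 3 else 0) (J (Suc v))"
        by (rule runs_mono) (use pos cost in simp_all)
    next
      assume "\<not> index_val (env(2 := v)) (Num 0) < index_val (env(2 := v))
        (IDiv (Var 0) (IPow (Num 2) (ISub (Var 0) (IAdd (Var 2) (Num 1)))))"
      then have "q' = 0" using env by (simp add: q'_def)
      then have "J (Suc v) s" using q inp sh by (simp add: J_def q'_def)
      then show "runs Skip (env(2 := v)) s (if 0 < n div 2 ^ (n - Suc v) then 5 * k ^ 3 else 0) (J (Suc v))"
        by (simp add: runs_def)
    qed
  qed
  \<comment> \<open>Since n < 2^n, the exponent starts at 0, where array 2 holds the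
    identity.\<close>
  have "J 0 s" using s by (simp add: J_def)
  then have "runs (For 2 (Var 0) p) env s
      (\<Sum>v<n. if 0 < n div 2 ^ (n - Suc v) then 5 * k ^ 3 else 0) (J n)"
    using runs_For_sum[where J = J and c = "\<lambda>v. if 0 < n div 2 ^ (n - Suc v) then 5 * k ^ 3 else 0",
        of env "Var 0" p 2 s] body env by simp
  then show ?thesis by (simp add: power_prog_def p_def J_def)
qed

text \<open>After reversing the order of summation, \<open>j\<close> contributes only if 2^j <= n,
  that is, for at most floor(log n) + 1 values.\<close>

lemma binary_digits_cost:
  assumes "1 \<le> n"
  shows "real (\<Sum>v<n. if 0 < n div 2 ^ (n - Suc v) then c else 0) \<le> real c * (log 2 (real n) + 1)"
proof -
  let ?A = "{j \<in> {..<n}. 0 < n div 2 ^ j}"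
  have "?A \<subseteq> {..nat \<lfloor>log 2 (real n)\<rfloor>}"
  proof safe
    fix j assume "0 < n div 2 ^ j"
    then have "2 ^ j \<le> n" by (simp add: div_greater_zero_iff)
    then have "real j \<le> log 2 (real n)"
      using assms by (simp add: le_log_iff powr_realpow)
    then show "j \<le> nat \<lfloor>log 2 (real n)\<rfloor>" by linarith
  qed
  then have "card ?A \<le> Suc (nat \<lfloor>log 2 (real n)\<rfloor>)"
    using card_mono[of "{..nat \<lfloor>log 2 (real n)\<rfloor>}" ?A] by simp
  then have "real (card ?A) \<le> real (nat \<lfloor>log 2 (real n)\<rfloor>) + 1" by linarith
  also have "\<dots> \<le> log 2 (real n) + 1" using assms by simp
  finally have card: "real (card ?A) \<le> log 2 (real n) + 1" .
  have "(\<Sum>v<n. if 0 < n div 2 ^ (n - Suc v) then c else 0) = (\<Sum>j<n. if 0 < n div 2 ^ j then c else 0)"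
    by (rule sum.nat_diff_reindex[where g = "\<lambda>j. if 0 < n div 2 ^ j then c else 0"])
  also have "\<dots> = card ?A * c"
    by (subst sum.inter_filter[symmetric]) simp_all
  finally have "real (\<Sum>v<n. if 0 < n div 2 ^ (n - Suc v) then c else 0) = real c * real (card ?A)"
    by simp
  also have "\<dots> \<le> real c * (log 2 (real n) + 1)" using card by (intro mult_left_mono) auto
  finally show ?thesis .
qed

text \<open>Array 5 receives the augmented matrix of the system \<open>(I - R\<^sup>n) y = e / x k\<close> in which \<open>e\<close> is the
  last unit vector and \<open>R\<close> the companion matrix.\<close>

definition system_prog :: prog where
  "system_prog = Seq (diag_prog 5)
     (Seq (For 2 k_minus_1 (For 3 k_minus_1 (Op FSub (5, Var 2, Var 3) (5, Var 2, Var 3) (2, Var 2, Var 3))))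
     (Seq (SetOne scratch) (Op FDiv (5, ISub (Var 1) (Num 2), k_minus_1) scratch (0, Num 0, Var 1))))"

lemma runs_system:
  assumes k: "2 \<le> k" and xk: "x k \<noteq> 0" and env: "env 1 = k" and s: "holds_input k x s"
  shows "runs system_prog env s (2 * k ^ 3) (\<lambda>s'.
    (\<forall>i<k-1. \<forall>j<k-1. s' (5, i, j) = (if i = j then 1 else 0) - s (2, i, j)) \<and>
    (\<forall>i<k-1. s' (5, i, k - 1) = (if i = k - 2 then 1 / x k else 0)))"
proof -
  define s1 where "s1 = (\<lambda>(a, i, j). if a = 5 \<and> i = j \<and> i < k - 1 then 1 else s (a, i, j))"
  define f where "f = (\<lambda>i j. s1 (5, i, j) - s1 (2, i, j))"
  have diag: "runs (diag_prog 5) env s 0 (\<lambda>s'. s' = s1)"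
    unfolding s1_def using env by (rule runs_diag)
  have sub: "runs (For 2 k_minus_1 (For 3 k_minus_1 (Op FSub (5, Var 2, Var 3) (5, Var 2, Var 3) (2, Var 2, Var 3))))
     env s1 ((k - 1) * ((k - 1) * 1)) (\<lambda>s'. sim s' (fill 5 (k - 1) (k - 1) f s1))"
    by (rule runs_fill) (use env in \<open>auto simp: runs_def sim_def fill_row_def fill_def f_def\<close>)
  have last: "runs (Seq (SetOne scratch) (Op FDiv (5, ISub (Var 1) (Num 2), k_minus_1) scratch (0, Num 0, Var 1)))
      env s' 1 (\<lambda>s''. sim s'' ((fill 5 (k - 1) (k - 1) f s1)((5, k - 2, k - 1) := 1 / x k)))"
    if "sim s' (fill 5 (k - 1) (k - 1) f s1)" for s'
  proof -
    have "s' (0, 0, k) = x k"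
      using that s k by (simp add: sim_def fill_def s1_def holds_input_def)
    then show ?thesis using that env xk by (simp add: runs_def) (simp add: sim_def)
  qed
  have "runs system_prog env s (0 + ((k - 1) * ((k - 1) * 1) + 1))
      (\<lambda>s''. sim s'' ((fill 5 (k - 1) (k - 1) f s1)((5, k - 2, k - 1) := 1 / x k)))"
    unfolding system_prog_def using runs_Seq[OF sub last] by (intro runs_Seq[OF diag]) simp
  then show ?thesis
  proof (rule runs_mono)
    fix s' assume s': "sim s' ((fill 5 (k - 1) (k - 1) f s1)((5, k - 2, k - 1) := 1 / x k))"
    have eq: "s' (5, i, j) = ((fill 5 (k - 1) (k - 1) f s1)((5, k - 2, k - 1) := 1 / x k)) (5, i, j)" for i j
      using s' by (simp add: sim_def)
    show "(\<forall>i<k-1. \<forall>j<k-1. s' (5, i, j) = (if i = j then 1 else 0) - s (2, i, j)) \<and>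
      (\<forall>i<k-1. s' (5, i, k - 1) = (if i = k - 2 then 1 / x k else 0))"
      using s unfolding eq by (auto simp: fill_def f_def s1_def holds_input_def)
  next
    have "(k - 1) * ((k - 1) * 1) \<le> k * (k * k)" using k by (intro mult_le_mono) auto
    also have "k * (k * k) = k ^ 3" by (simp add: power3_eq_cube)
    finally have "(k - 1) * ((k - 1) * 1) \<le> k ^ 3" .
    moreover have "1 \<le> k ^ 3" using k by simp
    ultimately show "0 + ((k - 1) * ((k - 1) * 1) + 1) \<le> 2 * k ^ 3" by linarith
  qed
qed

section \<open>Gauss-Jordan elimination\<close>

text \<open>Because \<open>c \<noteq> r\<close>, row \<open>r\<close> survives in \<open>T\<close>.
  Hence the added multiple vanishes on both null spaces.\<close>

lemma null_space_row_add:
  fixes S T :: "nat \<Rightarrow> nat \<Rightarrow> 'a::field"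
  assumes "c \<noteq> r" "c < m" "r < m"
    and T: "\<And>i j. i < m \<Longrightarrow> j < Suc m \<Longrightarrow> T i j = (if i = c then S c j + l * S r j else S i j)"
  shows "null_space m T = null_space m S"
proof -
  have T': "(\<Sum>j<Suc m. T i j * w j)
      = (\<Sum>j<Suc m. S i j * w j) + (if i = c then l * (\<Sum>j<Suc m. S r j * w j) else 0)"
    if "i < m" for i w
  proof -
    have "(\<Sum>j<Suc m. T i j * w j)
        = (\<Sum>j<Suc m. S i j * w j + (if i = c then l * (S r j * w j) else 0))"
      using that by (intro sum.cong) (auto simp: T algebra_simps)
    then show ?thesis by (simp only: sum.distrib sum_distrib_left) simp
  qed
  have "w \<in> null_space m T \<longleftrightarrow> w \<in> null_space m S" for w
  proof
    assume w: "w \<in> null_space m T"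
    have S0: "(\<Sum>j<Suc m. S i j * w j) = 0" if "i < m" "i \<noteq> c" for i
      using w T'[OF that(1), of w] that unfolding null_space_def by (simp del: sum.lessThan_Suc)
    have "(\<Sum>j<Suc m. S c j * w j) = 0"
      using w T'[OF assms(2), of w] S0[OF assms(3)] assms(1,2) unfolding null_space_def
      by (simp del: sum.lessThan_Suc)
    then show "w \<in> null_space m S" using S0 unfolding null_space_def by blast
  next
    assume w: "w \<in> null_space m S"
    then show "w \<in> null_space m T" using T' assms(1-3) unfolding null_space_def
      by (simp del: sum.lessThan_Suc)
  qed
  then show ?thesis by blast
qed

lemma null_space_row_scale:
  fixes S T :: "nat \<Rightarrow> nat \<Rightarrow> 'a::field"
  assumes "l \<noteq> 0"
    and T: "\<And>i j. i < m \<Longrightarrow> j < Suc m \<Longrightarrow> T i j = (if i = c then S c j / l else S i j)"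
  shows "null_space m T = null_space m S"
proof -
  have "(\<Sum>j<Suc m. T i j * w j)
      = (if i = c then (\<Sum>j<Suc m. S i j * w j) / l else (\<Sum>j<Suc m. S i j * w j))"
    if "i < m" for i w
  proof -
    have "(\<Sum>j<Suc m. T i j * w j)
        = (\<Sum>j<Suc m. if i = c then S i j * w j / l else S i j * w j)"
      using that by (intro sum.cong) (auto simp: T)
    then show ?thesis by (simp only: sum_divide_distrib) simp
  qed
  then show ?thesis using assms(1) by (auto simp: null_space_def simp del: sum.lessThan_Suc)
qed

definition unit_columns :: "nat \<Rightarrow> nat \<Rightarrow> (nat \<Rightarrow> nat \<Rightarrow> 'a::field) \<Rightarrow> bool" where
  "unit_columns m c S \<longleftrightarrow> (\<forall>j<c. \<forall>i<m. S i j = (if i = j then 1 else 0))"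

text \<open>A zero column below and including the pivot position would be a linear combination of the
  preceding unit columns.\<close>

lemma pivot_exists:
  fixes S :: "nat \<Rightarrow> nat \<Rightarrow> 'a::field"
  assumes c: "c < m" and unit: "unit_columns m c S" and zero: "\<And>i. c \<le> i \<Longrightarrow> i < m \<Longrightarrow> S i c = 0"
  obtains w where "w \<in> null_space m S" "w m = 0" "w c \<noteq> 0"
proof
  define w where "w = (\<lambda>j. if j < c then - S j c else if j = c then 1 else 0)"
  show "w m = 0" "w c \<noteq> 0" using c by (auto simp: w_def)
  show "w \<in> null_space m S"
    unfolding null_space_def
  proof safe
    fix i assume i: "i < m"
    have "(\<Sum>j<Suc m. S i j * w j)
        = (\<Sum>j<Suc m. (if j = i then if i < c then - S i c else 0 else 0) + (if j = c then S i c else 0))"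
      using unit i by (intro sum.cong) (auto simp: w_def unit_columns_def)
    also have "\<dots> = (if i < c then - S i c else 0) + S i c"
      using i c by (simp add: sum.distrib del: sum.lessThan_Suc)
    also have "\<dots> = 0" using zero[of i] i by simp
    finally show "(\<Sum>j<Suc m. S i j * w j) = 0" .
  qed
qed

section \<open>The elimination as a program\<close>

definition add_row_prog :: prog where
  "add_row_prog = For 4 (Var 1) (Op FAdd (5, Var 2, Var 4) (5, Var 2, Var 4) (5, Var 3, Var 4))"

text \<open>Rows are not exchanged: as long as the pivot is 0, the next lower row is added to the
  pivot row. Once a nonzero entry has been found, only the tests remain.\<close>

definition pivot_prog :: prog where
  "pivot_prog = For 3 k_minus_1 (IfLess (Var 2) (Var 3) (IfZero (5, Var 2, Var 2) add_row_prog Skip) Skip)"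

text \<open>The pivot, and later the multiplier of a row, has to survive a whole loop; it is kept in array 6
  because array 4 is not tracked.\<close>

definition normalize_prog :: prog where
  "normalize_prog = Seq (Copy (6, Num 0, Num 0) (5, Var 2, Var 2))
     (For 4 (Var 1) (Op FDiv (5, Var 2, Var 4) (5, Var 2, Var 4) (6, Num 0, Num 0)))"

definition subtract_row_prog :: prog where
  "subtract_row_prog = Seq (Copy (6, Num 0, Num 0) (5, Var 3, Var 2))
     (For 4 (Var 1) (Seq (Op FMul scratch (6, Num 0, Num 0) (5, Var 2, Var 4))
       (Op FSub (5, Var 3, Var 4) (5, Var 3, Var 4) scratch)))"

text \<open>The only comparison of indices is \<open><\<close>, so \<open>r \<noteq> c\<close> is
  tested by two comparisons.\<close>

definition clear_column_prog :: prog where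
  "clear_column_prog = For 3 k_minus_1
     (IfLess (Var 3) (Var 2) subtract_row_prog (IfLess (Var 2) (Var 3) subtract_row_prog Skip))"

definition gauss_jordan_prog :: prog where
  "gauss_jordan_prog = For 2 k_minus_1 (Seq pivot_prog (Seq normalize_prog clear_column_prog))"

lemma runs_add_row:
  assumes "env 1 = k" "env 2 = c" "env 3 = r" "r \<noteq> c"
  shows "runs add_row_prog env s (k * 1) (\<lambda>s'. sim s' (fill_row 5 c k (\<lambda>j. s (5, c, j) + s (5, r, j)) s))"
  unfolding add_row_prog_def
  by (rule runs_fill_row) (use assms in \<open>auto simp: runs_def sim_def fill_row_def\<close>)

lemma runs_normalize:
  assumes "env 1 = k" "env 2 = c" "s (5, c, c) \<noteq> 0"
  shows "runs normalize_prog env s (0 + k * 1)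
    (\<lambda>s'. sim s' (fill_row 5 c k (\<lambda>j. s (5, c, j) / s (5, c, c)) (s((6, 0, 0) := s (5, c, c)))))"
  unfolding normalize_prog_def
proof (rule runs_Seq)
  show "runs (Copy (6, Num 0, Num 0) (5, Var 2, Var 2)) env s 0 (\<lambda>s'. s' = s((6, 0, 0) := s (5, c, c)))"
    using assms by (simp add: runs_def)
  show "runs (For 4 (Var 1) (Op FDiv (5, Var 2, Var 4) (5, Var 2, Var 4) (6, Num 0, Num 0))) env s' (k * 1)
    (\<lambda>s'. sim s' (fill_row 5 c k (\<lambda>j. s (5, c, j) / s (5, c, c)) (s((6, 0, 0) := s (5, c, c)))))"
    if "s' = s((6, 0, 0) := s (5, c, c))" for s'
    by (rule runs_fill_row) (use assms that in \<open>auto simp: runs_def sim_def fill_row_def\<close>)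
qed

lemma runs_subtract_row:
  assumes "env 1 = k" "env 2 = c" "env 3 = r" "r \<noteq> c"
  shows "runs subtract_row_prog env s (0 + k * 2)
    (\<lambda>s'. sim s' (fill_row 5 r k (\<lambda>j. s (5, r, j) - s (5, r, c) * s (5, c, j)) (s((6, 0, 0) := s (5, r, c)))))"
  unfolding subtract_row_prog_def
proof (rule runs_Seq)
  show "runs (Copy (6, Num 0, Num 0) (5, Var 3, Var 2)) env s 0 (\<lambda>s'. s' = s((6, 0, 0) := s (5, r, c)))"
    using assms by (simp add: runs_def)
  show "runs (For 4 (Var 1) (Seq (Op FMul scratch (6, Num 0, Num 0) (5, Var 2, Var 4))
       (Op FSub (5, Var 3, Var 4) (5, Var 3, Var 4) scratch))) env s' (k * 2)
    (\<lambda>s'. sim s' (fill_row 5 r k (\<lambda>j. s (5, r, j) - s (5, r, c) * s (5, c, j)) (s((6, 0, 0) := s (5, r, c)))))"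
    if "s' = s((6, 0, 0) := s (5, r, c))" for s'
    by (rule runs_fill_row) (use assms that in \<open>auto simp: runs_def sim_def fill_row_def\<close>)
qed

text \<open>The loop invariant of the elimination: \<open>Z\<close> is the null space of the initial
  augmented matrix and stays the same throughout.\<close>

definition eliminated :: "(nat \<Rightarrow> 'a) set \<Rightarrow> nat \<Rightarrow> nat \<Rightarrow> 'a::field store \<Rightarrow> bool" where
  "eliminated Z m c s \<longleftrightarrow> null_space m (\<lambda>i j. s (5, i, j)) = Z \<and> unit_columns m c (\<lambda>i j. s (5, i, j))"

lemma runs_pivot:
  fixes s :: "'a::field store"
  assumes env: "env 1 = Suc m" "env 2 = c" and c: "c < m"
    and Z: "\<And>w j. w \<in> Z \<Longrightarrow> w m = 0 \<Longrightarrow> j < m \<Longrightarrow> w j = 0"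
    and s: "eliminated Z m c s"
  shows "runs pivot_prog env s (m * (Suc m + 1)) (\<lambda>s'. eliminated Z m c s' \<and> s' (5, c, c) \<noteq> 0)"
proof -
  \<comment> \<open>While the pivot is 0, every row inspected so far below it has a 0 in column
    \<open>c\<close>. If this still holds at the end, \<open>pivot_exists\<close> yields a nonzero
    vector of \<open>Z\<close> with last coordinate 0, contrary to the assumption on
    \<open>Z\<close>.\<close>
  define J where "J = (\<lambda>r s. eliminated Z m c s \<and> (s (5, c, c) = 0 \<longrightarrow> (\<forall>i<r. c < i \<longrightarrow> s (5, i, c) = 0)))"
  let ?p = "IfLess (Var 2) (Var 3) (IfZero (5, Var 2, Var 2) add_row_prog Skip) Skip"
  have body: "runs ?p (env(3 := r)) s (Suc m + 1) (J (Suc r))" if r: "r < m" and J: "J r s" for r s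
  proof (rule runs_IfLess)
    assume "index_val (env(3 := r)) (Var 2) < index_val (env(3 := r)) (Var 3)"
    then have cr: "c < r" using env by simp
    have el: "eliminated Z m c s" using J by (simp add: J_def)
    have "runs (IfZero (5, Var 2, Var 2) add_row_prog Skip) (env(3 := r)) s (Suc (Suc m * 1)) (J (Suc r))"
    proof (rule runs_IfZero)
      assume "s (address (env(3 := r)) (5, Var 2, Var 2)) = 0"
      then have 0: "s (5, c, c) = 0" using env by simp
      have "runs add_row_prog (env(3 := r)) s (Suc m * 1)
          (\<lambda>s'. sim s' (fill_row 5 c (Suc m) (\<lambda>j. s (5, c, j) + s (5, r, j)) s))"
        using env cr by (intro runs_add_row) auto
      then show "runs add_row_prog (env(3 := r)) s (Suc m * 1) (J (Suc r))"
      proof (rule runs_mono)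
        fix s' assume s': "sim s' (fill_row 5 c (Suc m) (\<lambda>j. s (5, c, j) + s (5, r, j)) s)"
        have eq: "s' (5, i, j) = (if i = c then s (5, c, j) + 1 * s (5, r, j) else s (5, i, j))"
          if "j < Suc m" for i j
          using s' that by (simp add: sim_def fill_row_def)
        have "null_space m (\<lambda>i j. s' (5, i, j)) = null_space m (\<lambda>i j. s (5, i, j))"
          using c r cr eq by (intro null_space_row_add[of c r]) auto
        \<comment> \<open>The added row lies below row \<open>c\<close>, so it has only zeros in the
          unit columns to the left of column \<open>c\<close>.\<close>
        moreover have "unit_columns m c (\<lambda>i j. s' (5, i, j))"
          using el c r cr by (auto simp: eliminated_def unit_columns_def eq)
        ultimately have "eliminated Z m c s'" using el by (simp add: eliminated_def)
        moreover have "s' (5, c, c) = s (5, r, c)" using c 0 by (simp add: eq)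
        moreover have "s' (5, i, c) = s (5, i, c)" if "c < i" for i using c that by (simp add: eq)
        ultimately show "J (Suc r) s'" using J 0 by (auto simp: J_def less_Suc_eq)
      qed simp
    next
      assume "s (address (env(3 := r)) (5, Var 2, Var 2)) \<noteq> 0"
      then show "runs Skip (env(3 := r)) s (Suc m * 1) (J (Suc r))"
        using env el by (simp add: runs_def J_def)
    qed
    then show "runs (IfZero (5, Var 2, Var 2) add_row_prog Skip) (env(3 := r)) s (Suc m + 1) (J (Suc r))"
      by (rule runs_mono) auto
  next
    assume "\<not> index_val (env(3 := r)) (Var 2) < index_val (env(3 := r)) (Var 3)"
    then have "r \<le> c" using env by simp
    then have "J (Suc r) s" using J by (auto simp: J_def)
    then show "runs Skip (env(3 := r)) s (Suc m + 1) (J (Suc r))" by (simp add: runs_def)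
  qed
  have "J 0 s" using s by (simp add: J_def)
  then have "runs pivot_prog env s (m * (Suc m + 1)) (J m)"
    using runs_For[where J = J, of env k_minus_1 ?p 3 "Suc m + 1" s] body env by (simp add: pivot_prog_def)
  then show ?thesis
  proof (rule runs_mono)
    fix s' assume J: "J m s'"
    have "s' (5, c, c) \<noteq> 0"
    proof
      assume 0: "s' (5, c, c) = 0"
      have "s' (5, i, c) = 0" if "c \<le> i" "i < m" for i
        using J 0 that by (cases "i = c") (auto simp: J_def)
      then obtain w where "w \<in> null_space m (\<lambda>i j. s' (5, i, j))" "w m = 0" "w c \<noteq> 0"
        using pivot_exists[of c m "\<lambda>i j. s' (5, i, j)"] c J by (auto simp: J_def eliminated_def)
      then show False using Z[of w c] c J by (auto simp: J_def eliminated_def)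
    qed
    then show "eliminated Z m c s' \<and> s' (5, c, c) \<noteq> 0" using J by (simp add: J_def)
  qed simp
qed

lemma runs_clear_column:
  fixes s :: "'a::field store"
  assumes env: "env 1 = Suc m" "env 2 = c" and c: "c < m"
    and s: "eliminated Z m c s" "s (5, c, c) = 1"
  shows "runs clear_column_prog env s (m * (Suc m * 2)) (eliminated Z m (Suc c))"
proof -
  define J where "J = (\<lambda>r s. eliminated Z m c s \<and> s (5, c, c) = 1 \<and> (\<forall>i<r. i \<noteq> c \<longrightarrow> s (5, i, c) = 0))"
  let ?p = "IfLess (Var 3) (Var 2) subtract_row_prog (IfLess (Var 2) (Var 3) subtract_row_prog Skip)"
  have sub: "runs subtract_row_prog (env(3 := r)) s (Suc m * 2) (J (Suc r))"
    if r: "r < m" "r \<noteq> c" and J: "J r s" for r s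
  proof -
    have el: "eliminated Z m c s" using J by (simp add: J_def)
    have "runs subtract_row_prog (env(3 := r)) s (0 + Suc m * 2)
      (\<lambda>s'. sim s' (fill_row 5 r (Suc m) (\<lambda>j. s (5, r, j) - s (5, r, c) * s (5, c, j)) (s((6, 0, 0) := s (5, r, c)))))"
      using env r by (intro runs_subtract_row) auto
    then show ?thesis
    proof (rule runs_mono)
      fix s' assume s': "sim s' (fill_row 5 r (Suc m) (\<lambda>j. s (5, r, j) - s (5, r, c) * s (5, c, j)) (s((6, 0, 0) := s (5, r, c))))"
      have eq: "s' (5, i, j) = (if i = r then s (5, r, j) + (- s (5, r, c)) * s (5, c, j) else s (5, i, j))"
        if "j < Suc m" for i j
        using s' that by (simp add: sim_def fill_row_def)
      have "null_space m (\<lambda>i j. s' (5, i, j)) = null_space m (\<lambda>i j. s (5, i, j))"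
        using c r eq by (intro null_space_row_add[of r c]) auto
      moreover have "unit_columns m c (\<lambda>i j. s' (5, i, j))"
        using el c r by (auto simp: eliminated_def unit_columns_def eq)
      ultimately have "eliminated Z m c s'" using el by (simp add: eliminated_def)
      then show "J (Suc r) s'" using J r c by (auto simp: J_def less_Suc_eq eq)
    qed simp
  qed
  have body: "runs ?p (env(3 := r)) s (Suc m * 2) (J (Suc r))" if r: "r < m" and J: "J r s" for r s
  proof (rule runs_IfLess)
    assume "index_val (env(3 := r)) (Var 3) < index_val (env(3 := r)) (Var 2)"
    then show "runs subtract_row_prog (env(3 := r)) s (Suc m * 2) (J (Suc r))"
      using env r J by (intro sub) auto
  next
    assume 1: "\<not> index_val (env(3 := r)) (Var 3) < index_val (env(3 := r)) (Var 2)"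
    show "runs (IfLess (Var 2) (Var 3) subtract_row_prog Skip) (env(3 := r)) s (Suc m * 2) (J (Suc r))"
    proof (rule runs_IfLess)
      assume "index_val (env(3 := r)) (Var 2) < index_val (env(3 := r)) (Var 3)"
      then show "runs subtract_row_prog (env(3 := r)) s (Suc m * 2) (J (Suc r))"
        using env r J by (intro sub) auto
    next
      assume "\<not> index_val (env(3 := r)) (Var 2) < index_val (env(3 := r)) (Var 3)"
      then have "r = c" using 1 env by simp
      then have "J (Suc r) s" using J by (auto simp: J_def less_Suc_eq)
      then show "runs Skip (env(3 := r)) s (Suc m * 2) (J (Suc r))" by (simp add: runs_def)
    qed
  qed
  have "J 0 s" using s by (simp add: J_def)
  then have "runs clear_column_prog env s (m * (Suc m * 2)) (J m)"
    using runs_For[where J = J, of env k_minus_1 ?p 3 "Suc m * 2" s] body env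
    by (simp add: clear_column_prog_def)
  then show ?thesis
    by (rule runs_mono) (auto simp: J_def eliminated_def unit_columns_def less_Suc_eq)
qed

lemma runs_gauss_jordan:
  fixes s :: "'a::field store"
  assumes env: "env 1 = Suc m"
    and Z: "\<And>w j. w \<in> Z \<Longrightarrow> w m = 0 \<Longrightarrow> j < m \<Longrightarrow> w j = 0"
    and s: "null_space m (\<lambda>i j. s (5, i, j)) = Z"
  shows "runs gauss_jordan_prog env s (m * (m * (Suc m + 1) + (Suc m + m * (Suc m * 2)))) (eliminated Z m m)"
proof -
  let ?p = "Seq pivot_prog (Seq normalize_prog clear_column_prog)"
  have body: "runs ?p (env(2 := c)) s (m * (Suc m + 1) + (Suc m + m * (Suc m * 2))) (eliminated Z m (Suc c))"
    if c: "c < m" and el: "eliminated Z m c s" for c s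
  proof (rule runs_Seq)
    show "runs pivot_prog (env(2 := c)) s (m * (Suc m + 1)) (\<lambda>s'. eliminated Z m c s' \<and> s' (5, c, c) \<noteq> 0)"
      using env c Z el by (intro runs_pivot) auto
    fix s' assume s': "eliminated Z m c s' \<and> s' (5, c, c) \<noteq> 0"
    show "runs (Seq normalize_prog clear_column_prog) (env(2 := c)) s' (Suc m + m * (Suc m * 2)) (eliminated Z m (Suc c))"
    proof (rule runs_Seq)
      have "runs normalize_prog (env(2 := c)) s' (0 + Suc m * 1)
        (\<lambda>s''. sim s'' (fill_row 5 c (Suc m) (\<lambda>j. s' (5, c, j) / s' (5, c, c)) (s'((6, 0, 0) := s' (5, c, c)))))"
        using env s' by (intro runs_normalize) auto
      then show "runs normalize_prog (env(2 := c)) s' (Suc m) (\<lambda>s''. eliminated Z m c s'' \<and> s'' (5, c, c) = 1)"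
      proof (rule runs_mono)
        fix s'' assume s'': "sim s'' (fill_row 5 c (Suc m) (\<lambda>j. s' (5, c, j) / s' (5, c, c)) (s'((6, 0, 0) := s' (5, c, c))))"
        have eq: "s'' (5, i, j) = (if i = c then s' (5, c, j) / s' (5, c, c) else s' (5, i, j))"
          if "j < Suc m" for i j
          using s'' that by (simp add: sim_def fill_row_def)
        have "null_space m (\<lambda>i j. s'' (5, i, j)) = null_space m (\<lambda>i j. s' (5, i, j))"
          using s' eq by (intro null_space_row_scale[of "s' (5, c, c)" _ _ c]) auto
        moreover have "unit_columns m c (\<lambda>i j. s'' (5, i, j))"
          using s' c by (auto simp: eliminated_def unit_columns_def eq)
        moreover have "s'' (5, c, c) = 1" using s' c by (simp add: eq)
        ultimately show "eliminated Z m c s'' \<and> s'' (5, c, c) = 1" using s' by (simp add: eliminated_def)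
      qed simp
      show "runs clear_column_prog (env(2 := c)) s'' (m * (Suc m * 2)) (eliminated Z m (Suc c))"
        if "eliminated Z m c s'' \<and> s'' (5, c, c) = 1" for s''
        using env c that by (intro runs_clear_column) auto
    qed
  qed
  have "eliminated Z m 0 s" using s by (simp add: eliminated_def unit_columns_def)
  then show ?thesis
    using runs_For[where J = "eliminated Z m", of env k_minus_1 ?p 2
        "m * (Suc m + 1) + (Suc m + m * (Suc m * 2))" s] body env
    by (simp add: gauss_jordan_prog_def)
qed

text \<open>The coefficient part has become the identity, so row \<open>i\<close> applied to the
  null vector (y, -1) says that \<open>y i\<close> minus the last entry of that row is 0.\<close>

lemma eliminated_solution:
  assumes "eliminated Z m m s" and "(\<lambda>j. if j < m then y j else -1) \<in> Z" and i: "i < m"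
  shows "s (5, i, m) = y i"
proof -
  have "(\<lambda>j. if j < m then y j else -1) \<in> null_space m (\<lambda>i j. s (5, i, j))"
    using assms by (simp add: eliminated_def)
  then have "(\<Sum>j<Suc m. s (5, i, j) * (if j < m then y j else -1)) = 0"
    using i unfolding null_space_def by blast
  then have "(\<Sum>j<m. s (5, i, j) * y j) = s (5, i, m)" by simp
  moreover have "(\<Sum>j<m. s (5, i, j) * y j) = (\<Sum>j<m. if i = j then y j else 0)"
    using assms(1) i by (intro sum.cong) (auto simp: eliminated_def unit_columns_def)
  ultimately show ?thesis using i by simp
qed

text \<open>The results belong in columns 1 to \<open>k - 1\<close>, but loops start at 0. The
  iteration for 0 copies a value to column 0, which is not read as output.\<close>

definition initial_terms_prog :: prog where
  "initial_terms_prog = Seq (diag_prog 2) (Seq power_prog (Seq system_prog (Seq gauss_jordan_prog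
     (For 2 (Var 1) (Copy (1, Num 0, Var 2) (5, ISub (Var 2) (Num 1), k_minus_1))))))"

lemma runs_initial_terms:
  fixes x :: "nat \<Rightarrow> 'a::field"
  assumes k: "2 \<le> k" "k \<le> n" and xk: "x k \<noteq> 0"
    and N: "N \<in> carrier_mat n n" "inverts_mat (diag_circulant n k x) N"
      "inverts_mat N (diag_circulant n k x)"
  shows "runs initial_terms_prog (input_env n k) (input_store k x)
    ((\<Sum>v<n. if 0 < n div 2 ^ (n - Suc v) then 5 * k ^ 3 else 0) + 6 * k ^ 3)
    (\<lambda>s. \<forall>i\<in>{1..k-1}. s (1, 0, i) = N $$ (i - 1, 0))"
proof -
  let ?env = "input_env n k"
  let ?c = "\<Sum>v<n. if 0 < n div 2 ^ (n - Suc v) then 5 * k ^ 3 else 0"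
  obtain m where m: "k = Suc m" using k by (cases k) auto
  let ?g = "m * (m * (Suc m + 1) + (Suc m + m * (Suc m * 2)))"
  have env: "?env 0 = n" "?env 1 = k" by (simp_all add: input_env_def)
  have "runs initial_terms_prog ?env (input_store k x) (0 + (?c + (2 * k ^ 3 + (?g + k * 0))))
    (\<lambda>s. \<forall>i\<in>{1..k-1}. s (1, 0, i) = N $$ (i - 1, 0))"
    unfolding initial_terms_prog_def
  proof (rule runs_Seq)
    show "runs (diag_prog 2) ?env (input_store k x) 0
      (\<lambda>s'. s' = (\<lambda>(a, i, j). if a = 2 \<and> i = j \<and> i < k - 1 then 1 else input_store k x (a, i, j)))"
      by (rule runs_diag) (rule env(2))
  next
    fix s :: "'a store" assume s: "s = (\<lambda>(a, i, j). if a = 2 \<and> i = j \<and> i < k - 1 then 1 else input_store k x (a, i, j))"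
    show "runs (Seq power_prog (Seq system_prog (Seq gauss_jordan_prog
       (For 2 (Var 1) (Copy (1, Num 0, Var 2) (5, ISub (Var 2) (Num 1), k_minus_1)))))) ?env s
       (?c + (2 * k ^ 3 + (?g + k * 0))) (\<lambda>s. \<forall>i\<in>{1..k-1}. s (1, 0, i) = N $$ (i - 1, 0))"
    proof (rule runs_Seq)
      have "shift_matrix k x 0 (\<lambda>i j. s (2, i, j))"
        by (rule shift_matrix_0) (simp add: s input_store_def)
      moreover have "holds_input k x s" by (simp add: holds_input_def s input_store_def)
      ultimately show "runs power_prog ?env s ?c (\<lambda>s'. holds_input k x s' \<and> shift_matrix k x n (\<lambda>i j. s' (2, i, j)))"
        using k(1) xk env by (intro runs_power)
    next
      fix s1 :: "'a store" assume s1: "holds_input k x s1 \<and> shift_matrix k x n (\<lambda>i j. s1 (2, i, j))"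
      show "runs (Seq system_prog (Seq gauss_jordan_prog
         (For 2 (Var 1) (Copy (1, Num 0, Var 2) (5, ISub (Var 2) (Num 1), k_minus_1))))) ?env s1
         (2 * k ^ 3 + (?g + k * 0)) (\<lambda>s. \<forall>i\<in>{1..k-1}. s (1, 0, i) = N $$ (i - 1, 0))"
      proof (rule runs_Seq)
        show "runs system_prog ?env s1 (2 * k ^ 3) (\<lambda>s'.
          (\<forall>i<k-1. \<forall>j<k-1. s' (5, i, j) = (if i = j then 1 else 0) - s1 (2, i, j)) \<and>
          (\<forall>i<k-1. s' (5, i, k - 1) = (if i = k - 2 then 1 / x k else 0)))"
          using k(1) xk env(2) s1 by (intro runs_system) auto
      next
        fix s2 :: "'a store" assume s2: "(\<forall>i<k-1. \<forall>j<k-1. s2 (5, i, j) = (if i = j then 1 else 0) - s1 (2, i, j)) \<and>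
          (\<forall>i<k-1. s2 (5, i, k - 1) = (if i = k - 2 then 1 / x k else 0))"
        define Z where "Z = null_space m (\<lambda>i j. s2 (5, i, j))"
        have Z: "w j = 0" if "w \<in> Z" "w m = 0" "j < m" for w j
          using null_space_trivial[OF k xk N(1,3), of "\<lambda>i j. s1 (2, i, j)" "\<lambda>i j. s2 (5, i, j)" w j]
            s1 s2 that by (simp add: Z_def m)
        have y: "(\<lambda>j. if j < m then N $$ (j, 0) else -1) \<in> Z"
          using inverse_in_null_space[OF k xk N(1,2), of "\<lambda>i j. s1 (2, i, j)" "\<lambda>i j. s2 (5, i, j)"]
            s1 s2 by (simp add: Z_def m)
        show "runs (Seq gauss_jordan_prog
         (For 2 (Var 1) (Copy (1, Num 0, Var 2) (5, ISub (Var 2) (Num 1), k_minus_1)))) ?env s2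
         (?g + k * 0) (\<lambda>s. \<forall>i\<in>{1..k-1}. s (1, 0, i) = N $$ (i - 1, 0))"
        proof (rule runs_Seq)
          show "runs gauss_jordan_prog ?env s2 ?g (eliminated Z m m)"
            using env Z by (intro runs_gauss_jordan) (auto simp: Z_def m)
        next
          fix s3 assume s3: "eliminated Z m m s3"
          have "runs (For 2 (Var 1) (Copy (1, Num 0, Var 2) (5, ISub (Var 2) (Num 1), k_minus_1))) ?env s3
            (k * 0) (\<lambda>s'. sim s' (fill_row 1 0 k (\<lambda>j. s3 (5, j - 1, k - 1)) s3))"
            by (rule runs_fill_row) (use env in \<open>auto simp: runs_def sim_def fill_row_def\<close>)
          then show "runs (For 2 (Var 1) (Copy (1, Num 0, Var 2) (5, ISub (Var 2) (Num 1), k_minus_1))) ?env s3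
            (k * 0) (\<lambda>s. \<forall>i\<in>{1..k-1}. s (1, 0, i) = N $$ (i - 1, 0))"
          proof (rule runs_mono)
            fix s4 assume "sim s4 (fill_row 1 0 k (\<lambda>j. s3 (5, j - 1, k - 1)) s3)"
            then show "\<forall>i\<in>{1..k-1}. s4 (1, 0, i) = N $$ (i - 1, 0)"
              using eliminated_solution[OF s3 y] by (auto simp: sim_def fill_row_def m)
          qed simp
        qed
      qed
    qed
  qed
  then show ?thesis
  proof (rule runs_mono)
    \<comment> \<open>The count for the elimination is 3 m^3 + 5 m^2 + m with m = k - 1. Together
      with the bound 2 k^3 for setting up the system this gives the constant 6.\<close>
    have "?g \<le> 4 * k ^ 3" by (simp add: m power3_eq_cube algebra_simps)
    then show "0 + (?c + (2 * k ^ 3 + (?g + k * 0))) \<le> ?c + 6 * k ^ 3" by simp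
  qed
qed

section \<open>The theorem\<close>

theorem mainTheorem3:
  shows "(\<forall>(k::nat) (n::nat) (x :: nat \<Rightarrow> 'a::field) Minv.
      k \<ge> 2 \<and> n \<ge> 2 * k - 2 \<and> x k \<noteq> 0 \<and>
      Minv \<in> carrier_mat n n \<and>
      inverts_mat (diag_circulant n k x) Minv \<and> inverts_mat Minv (diag_circulant n k x) \<longrightarrow>
      (let p = n - (2 * k - 2); y = (\<lambda>i. Minv $$ (i - 1, 0)) in
        (\<forall>i\<in>{1..k-1}.
          y i = (-1) ^ ((i + 1) + k * p) * x k ^ p / det (diag_circulant n k x) *
            det (four_block_mat (T_mat k x ^\<^sub>m p * delete_col i (A_mat k x)) (B_mat k x)
                                (delete_col i (C_mat k x)) (D_mat k x))) \<and>
        (\<forall>i\<in>{k..n}. y i = - (\<Sum>j=1..k-1. x j * y (i - k + j)) / x k) \<and>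
        circulant n Minv \<and>
        (\<forall>N. circulant n N \<and>
             (\<forall>i\<in>{1..k-1}. N $$ (i - 1, 0) = y i) \<and>
             (\<forall>i\<in>{k..n}. N $$ (i - 1, 0) = - (\<Sum>j=1..k-1. x j * N $$ (i - k + j - 1, 0)) / x k)
             \<longrightarrow> N = Minv)))
    \<and>
    (\<exists>P (K::real). \<forall>(k::nat) (n::nat) (x :: nat \<Rightarrow> 'a) Minv.
      k \<ge> 2 \<and> n \<ge> 2 * k - 2 \<and> x k \<noteq> 0 \<and>
      Minv \<in> carrier_mat n n \<and>
      inverts_mat (diag_circulant n k x) Minv \<and> inverts_mat Minv (diag_circulant n k x) \<longrightarrow>
      (\<exists>t. computes_with_cost P n k x (k - 1) (\<lambda>i. Minv $$ (i - 1, 0)) t \<and>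
           real t \<le> K * (real k ^ 3 * log 2 (real n) + real k ^ 4)))"
proof (intro conjI allI impI, goal_cases)
  case (1 k n x Minv)
  then have k: "2 \<le> k" and n: "2 * k - 2 \<le> n" and xk: "x k \<noteq> 0" and N: "Minv \<in> carrier_mat n n"
    and inv: "inverts_mat (diag_circulant n k x) Minv" "inverts_mat Minv (diag_circulant n k x)"
    by simp_all
  have kn: "k \<le> n" and n': "n = 2 * k - 2 + (n - (2 * k - 2))" using k n by simp_all
  note rec = inverse_diag_circulant_recursion[OF k kn xk N inv(1)]
  note circ = circulant_inverse_diag_circulant[OF k kn N inv]
  have "M = Minv" if "circulant n M"
      "\<forall>i\<in>{1..k-1}. M $$ (i - 1, 0) = Minv $$ (i - 1, 0)"
      "\<forall>i\<in>{k..n}. M $$ (i - 1, 0) = - (\<Sum>j=1..k-1. x j * M $$ (i - k + j - 1, 0)) / x k" for M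
    using that by (intro circulant_recursion_unique[OF that(1) circ k _ _ rec]) auto
  then show ?case
    unfolding Let_def
    using inverse_diag_circulant_initial[OF k n' xk N inv(1)] rec circ by blast
next
  case 2
  \<comment> \<open>One program serves all k, n and x. The constant 11 collects the k^3 terms: 5
    from the additional 1 in the bound on the number of digits, and 6 from the linear
    system.\<close>
  show ?case
  proof (intro exI[of _ initial_terms_prog] exI[of _ "11 :: real"] allI impI, goal_cases)
    case (1 k n x Minv)
    then have k: "2 \<le> k" and n: "2 * k - 2 \<le> n" and xk: "x k \<noteq> 0" and N: "Minv \<in> carrier_mat n n"
      and inv: "inverts_mat (diag_circulant n k x) Minv" "inverts_mat Minv (diag_circulant n k x)"
      by simp_all
    have kn: "k \<le> n" using k n by simp
    let ?c = "\<Sum>v<n. if 0 < n div 2 ^ (n - Suc v) then 5 * k ^ 3 else 0"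
    obtain s t where st: "exec initial_terms_prog (input_env n k) (input_store k x, 0) = Some (s, t)"
      and t: "t \<le> ?c + 6 * k ^ 3" and y: "\<forall>i\<in>{1..k-1}. s (1, 0, i) = Minv $$ (i - 1, 0)"
      using runs_initial_terms[OF k kn xk N inv] by (auto simp: runs_def wp_def dest: spec[of _ 0])
    have "real ?c \<le> real (5 * k ^ 3) * (log 2 (real n) + 1)"
      using k kn by (intro binary_digits_cost) simp
    with t have "real t \<le> 5 * real k ^ 3 * (log 2 (real n) + 1) + 6 * real k ^ 3"
      by (simp flip: of_nat_le_iff[where 'a = real])
    also have "\<dots> = 5 * (real k ^ 3 * log 2 (real n)) + 11 * real k ^ 3"
      by (simp add: algebra_simps)
    also have "\<dots> \<le> 11 * (real k ^ 3 * log 2 (real n)) + 11 * real k ^ 4"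
    proof -
      have "0 \<le> real k ^ 3 * log 2 (real n)" using k kn by simp
      moreover have "real k ^ 3 \<le> real k ^ 4" using k by (intro power_increasing) auto
      ultimately show ?thesis by linarith
    qed
    finally have "real t \<le> 11 * (real k ^ 3 * log 2 (real n) + real k ^ 4)" by (simp add: algebra_simps)
    then show ?case using st y by (auto simp: computes_with_cost_def)
  qed
qed

end
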